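(* Let $\mathsf{k}$ be a field of characteristic zero and let $X=\{P_1,\dots,P_s\}$ be a set of $s$ distinct ($\mathsf{k}$-rational) points in $\mathbb{P}^n_{\mathsf{k}}$ lying on a rational normal curve. Let $L_i$ be the linear form dual to $P_i$, and let $A$ be an Artinian Gorenstein quotient of $A(X)$ with dual generator $F=\sum_{i=1}^s\alpha_iL_i^d$, where $d\geq 2\tau(X)$ and $\alpha_i\in\mathsf{k}$, $\alpha_i\neq 0$ for every $i$. Then $A$ satisfies the strong Lefschetz property.
   Context: Let $S=\mathsf{k}[x_0,\dots,x_n]$ (standard grading) act on $R=\mathsf{k}[X_0,\dots,X_n]$ by letting $x_i$ act as $\partial/\partial X_i$; the action is denoted $\circ$. For $F\in R$ homogeneous of degree $d$, $F\ne 0$, the algebra with Macaulay dual generator $F$ is $A=S/\mathrm{Ann}_S(F)$, $\mathrm{Ann}_S(F)=\{g\in S: g\circ F=0\}$; it is Artinian Gorenstein of socle degree $d$. For a finite set $X$ of $s$ distinct points in $\mathbb{P}^n_{\mathsf{k}}$, $I(X)\subset S$ is the homogeneous ideal generated by forms vanishing on $X$, $A(X)=S/I(X)$, $h_{A(X)}(i)=\dim_{\mathsf{k}}A(X)_i$, and $\tau(X)=\min\{i: h_{A(X)}(i)=s\}$. For $P=(a_0:\dots:a_n)$ (with a fixed choice of coordinates) the dual linear form is $L=a_0X_0+\cdots+a_nX_n\in R$. If $F=\sum_i\alpha_iL_i^d$ with the $L_i$ dual to the points $P_i\in X$, then $I(X)\subseteq\mathrm{Ann}_S(F)$, so $S/\mathrm{Ann}_S(F)$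 is a quotient of $A(X)$. A rational normal curve in $\mathbb{P}^n$ is the image of the degree-$n$ Veronese embedding $\mathbb{P}^1\to\mathbb{P}^n$, up to linear change of coordinates over $\mathsf{k}$. A graded Artinian algebra $A$ satisfies the strong Lefschetz property (SLP) if there is a linear form $\ell\in A_1$ such that $\times\ell^j:A_i\to A_{i+j}$ has maximal rank for all $i,j\geq 0$. *)

theory Defs
  imports
    "HOL-Analysis.Analysis"
    "HOL-Algebra.Algebraic_Closure_Type"
    "HOL-Library.Poly_Mapping"
begin

text \<open>Polynomials over \<open>'k\<close> in the variables \<open>x\<^sub>v\<close>, one for each \<open>v :: 'v\<close>; an exponent vector is a
  \<open>'v \<Rightarrow>\<^sub>0 nat\<close>. With \<open>CARD('v) = n + 1\<close> this single type plays the role of both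
  \<open>S = k[x\<^sub>0,\<dots>,x\<^sub>n]\<close> and \<open>R = k[X\<^sub>0,\<dots>,X\<^sub>n]\<close>.\<close>

type_synonym ('k, 'v) mpoly = "('v \<Rightarrow>\<^sub>0 nat) \<Rightarrow>\<^sub>0 'k"

abbreviation lookup :: "('a \<Rightarrow>\<^sub>0 'b::zero) \<Rightarrow> 'a \<Rightarrow> 'b" where
  "lookup \<equiv> Poly_Mapping.lookup"

abbreviation keys :: "('a \<Rightarrow>\<^sub>0 'b::zero) \<Rightarrow> 'a set" where
  "keys \<equiv> Poly_Mapping.keys"

definition const_poly :: "'k::zero \<Rightarrow> ('k, 'v) mpoly" where
  "const_poly c = Poly_Mapping.single 0 c"

definition var_poly :: "'v \<Rightarrow> ('k::zero_neq_one, 'v) mpoly" where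
  "var_poly v = Poly_Mapping.single (Poly_Mapping.single v 1) 1"

definition forms :: "nat \<Rightarrow> ('k::zero, 'v::finite) mpoly set" where
  "forms i = {f. \<forall>m\<in>keys f. (\<Sum>v\<in>UNIV. lookup m v) = i}"

definition eval_poly :: "('k::comm_semiring_1, 'v::finite) mpoly \<Rightarrow> 'k ^ 'v \<Rightarrow> 'k" where
  "eval_poly f p = (\<Sum>m\<in>keys f. lookup f m * (\<Prod>v\<in>UNIV. p $ v ^ lookup m v))"

abbreviation mpoly_ring :: "('k::field_char_0, 'v::finite) mpoly ring" where
  "mpoly_ring \<equiv> ring_of_type_algebra"


section \<open>The action by differentiation\<close>

text \<open>The monomial \<open>x\<^sup>m\<close> sends \<open>X\<^sup>b\<close> to \<open>(\<Prod>v. b\<^sub>v! / (b\<^sub>v - m\<^sub>v)!) X\<^sup>b\<^sup>-\<^sup>m\<close> if \<open>m \<le> b\<close> componentwise,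
  and to \<open>0\<close> otherwise; \<open>diff_act\<close> is the bilinear extension. The lemmas below confirm
  that \<open>x\<^sub>v\<close> acts as the partial derivative and that this is a ring action.\<close>

definition diff_monom ::
    "('v \<Rightarrow>\<^sub>0 nat) \<Rightarrow> ('v \<Rightarrow>\<^sub>0 nat) \<Rightarrow> ('k::field_char_0, 'v::finite) mpoly" where
  "diff_monom m b = Poly_Mapping.single (b - m)
     (\<Prod>v\<in>UNIV. if lookup m v \<le> lookup b v
                then fact (lookup b v) / fact (lookup b v - lookup m v) else 0)"

definition diff_act :: "('k::field_char_0, 'v::finite) mpoly \<Rightarrow> ('k, 'v) mpoly \<Rightarrow> ('k, 'v) mpoly" where
  "diff_act g F = (\<Sum>m\<in>keys g. \<Sum>b\<in>keys F.
     const_poly (lookup g m * lookup F b) * diff_monom m b)"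

lemma sum_monomials: "(\<Sum>m\<in>keys p. Poly_Mapping.single m (lookup p m)) = p"
  by (rule poly_mapping_eqI)
     (auto simp: lookup_sum lookup_single when_def sum.delta' in_keys_iff)

lemma lookup_const_mult: "lookup (const_poly c * p) m = c * lookup p m"
  for p :: "('k::comm_ring_1, 'v) mpoly"
  unfolding const_poly_def mult_map_scale_conv_mult[symmetric]
  by (simp add: Poly_Mapping.map.rep_eq when_def)

lemma lookup_diff_act:
  fixes g F :: "('k::field_char_0, 'v::finite) mpoly"
  shows "lookup (diff_act g F) c = (\<Sum>m\<in>keys g. lookup g m * lookup F (c + m) *
           (\<Prod>v\<in>UNIV. fact (lookup c v + lookup m v) / fact (lookup c v)))"
proof -
  have inner: "(\<Sum>b\<in>keys F.
        lookup (const_poly (lookup g m * lookup F b) * diff_monom m b) c) =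
      lookup g m * lookup F (c + m) * (\<Prod>v\<in>UNIV. fact (lookup c v + lookup m v) / fact (lookup c v))"
    (is "(\<Sum>b\<in>_. ?t b) = ?r") for m
  proof -
    have zero: "?t b = 0" if "b \<noteq> c + m" for b
    proof (cases "b - m = c")
      case True
      have "\<exists>v. \<not> lookup m v \<le> lookup b v"
      proof (rule ccontr)
        assume "\<not> ?thesis"
        then have "b = (b - m) + m"
          by (intro poly_mapping_eqI) (simp add: lookup_add lookup_minus)
        with True that show False by simp
      qed
      then show ?thesis
        by (auto simp: lookup_const_mult diff_monom_def lookup_single when_def)
    next
      case False
      then show ?thesis
        by (simp add: lookup_const_mult diff_monom_def lookup_single)
    qed
    have main: "?t (c + m) = ?r"
      by (simp add: lookup_const_mult diff_monom_def lookup_add)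
    show ?thesis
    proof (cases "c + m \<in> keys F")
      case True
      have "(\<Sum>b\<in>keys F. ?t b) = (\<Sum>b\<in>{c + m}. ?t b)"
        using True zero by (intro sum.mono_neutral_right) auto
      then show ?thesis using main by simp
    next
      case False
      then have "(\<Sum>b\<in>keys F. ?t b) = 0"
        using zero by (intro sum.neutral) metis
      moreover have "lookup F (c + m) = 0"
        using False by (simp add: in_keys_iff)
      ultimately show ?thesis by simp
    qed
  qed
  show ?thesis
    unfolding diff_act_def lookup_sum inner ..
qed

lemma diff_act_var:
  fixes F :: "('k::field_char_0, 'v::finite) mpoly"
  shows "lookup (diff_act (var_poly v) F) c =
           of_nat (lookup c v + 1) * lookup F (c + Poly_Mapping.single v 1)"
proof -
  have "(\<Prod>w\<in>UNIV. fact (lookup c w + lookup (Poly_Mapping.single v 1) w) / fact (lookup c w)) =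
      (\<Prod>w\<in>UNIV. if w = v then of_nat (lookup c v + 1) else (1 :: 'k))"
    by (intro prod.cong) (auto simp: lookup_single field_simps)
  then show ?thesis
    by (simp add: lookup_diff_act var_poly_def)
qed

lemma diff_act_mult:
  fixes g h F :: "('k::field_char_0, 'v::finite) mpoly"
  shows "diff_act (g * h) F = diff_act g (diff_act h F)"
proof (rule poly_mapping_eqI)
  fix c
  define w :: "('v \<Rightarrow>\<^sub>0 nat) \<Rightarrow> ('v \<Rightarrow>\<^sub>0 nat) \<Rightarrow> 'k" where
    "w c m = (\<Prod>v\<in>UNIV. fact (lookup c v + lookup m v) / fact (lookup c v))" for c m
  have w_add: "w c (m + m') = w c m * w (c + m) m'" for c m m'
    unfolding w_def prod.distrib[symmetric]
    by (intro prod.cong) (auto simp: lookup_add add.assoc)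
  define \<phi> where "\<phi> m = lookup F (c + m) * w c m" for m
  have act: "lookup (diff_act p G) b =
      (\<Sum>m\<in>keys p. lookup p m * (lookup G (b + m) * w b m))"
    for p G :: "('k, 'v) mpoly" and b
    by (simp add: lookup_diff_act w_def mult.assoc)
  have actA: "lookup (diff_act p F) c = (\<Sum>m\<in>A. lookup p m * \<phi> m)"
    if "finite A" "keys p \<subseteq> A" for p A
    unfolding act \<phi>_def using that
    by (intro sum.mono_neutral_left) (auto simp: in_keys_iff)
  have gh: "g * h = (\<Sum>m\<in>keys g. \<Sum>m'\<in>keys h.
      Poly_Mapping.single (m + m') (lookup g m * lookup h m'))"
  proof -
    have "g * h = (\<Sum>m\<in>keys g. Poly_Mapping.single m (lookup g m)) *
        (\<Sum>m\<in>keys h. Poly_Mapping.single m (lookup h m))"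
      by (simp only: sum_monomials)
    then show ?thesis
      by (simp add: sum_product mult_single)
  qed
  define B where "B = (\<lambda>(m, m'). m + m') ` (keys g \<times> keys h)"
  have B: "finite B" "keys (g * h) \<subseteq> B"
    using keys_mult[of g h] by (auto simp: B_def)
  have "lookup (diff_act (g * h) F) c = (\<Sum>k\<in>B. lookup (g * h) k * \<phi> k)"
    by (rule actA[OF B])
  also have "\<dots> = (\<Sum>k\<in>B. \<Sum>m\<in>keys g. \<Sum>m'\<in>keys h.
      if m + m' = k then lookup g m * lookup h m' * \<phi> k else 0)"
    by (intro sum.cong refl)
       (simp add: gh lookup_sum sum_distrib_right lookup_single when_def if_distrib[of "\<lambda>x. x * _"]
        cong: if_cong)
  also have "\<dots> = (\<Sum>m\<in>keys g. \<Sum>k\<in>B. \<Sum>m'\<in>keys h.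
      if m + m' = k then lookup g m * lookup h m' * \<phi> k else 0)"
    by (rule sum.swap)
  also have "\<dots> = (\<Sum>m\<in>keys g. \<Sum>m'\<in>keys h. \<Sum>k\<in>B.
      if m + m' = k then lookup g m * lookup h m' * \<phi> k else 0)"
    by (intro sum.cong refl sum.swap)
  also have "\<dots> = (\<Sum>m\<in>keys g. \<Sum>m'\<in>keys h.
      lookup g m * lookup h m' * \<phi> (m + m'))"
    using B(1) by (intro sum.cong refl) (auto simp: B_def)
  also have "\<dots> = lookup (diff_act g (diff_act h F)) c"
    unfolding act sum_distrib_left sum_distrib_right
    by (intro sum.cong refl) (simp add: \<phi>_def w_add add.assoc mult_ac)
  finally show "lookup (diff_act (g * h) F) c = lookup (diff_act g (diff_act h F)) c" .
qed

definition annihilator :: "('k::field_char_0, 'v::finite) mpoly \<Rightarrow> ('k, 'v) mpoly set" where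
  "annihilator F = {g. diff_act g F = 0}"


section \<open>Graded quotients of the polynomial ring\<close>

text \<open>For a homogeneous ideal \<open>I\<close>: the copy of \<open>k\<close> in \<open>S/I\<close>, and the graded pieces of \<open>S/I\<close> as the
  images of those of \<open>S\<close>. Dimensions are those of \<open>HOL-Algebra\<close>, taken inside the ring
  \<open>S/I\<close> over that copy of \<open>k\<close>.\<close>

definition quot_scalars :: "('k::field_char_0, 'v::finite) mpoly set \<Rightarrow> ('k, 'v) mpoly set set" where
  "quot_scalars I = (\<lambda>c. I +>\<^bsub>mpoly_ring\<^esub> const_poly c) ` UNIV"

definition quot_piece ::
    "('k::field_char_0, 'v::finite) mpoly set \<Rightarrow> nat \<Rightarrow> ('k, 'v) mpoly set set" where
  "quot_piece I i = (\<lambda>f. I +>\<^bsub>mpoly_ring\<^esub> f) ` forms i"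

definition hilbert_fun :: "('k::field_char_0, 'v::finite) mpoly set \<Rightarrow> nat \<Rightarrow> nat" where
  "hilbert_fun I i = ring.dim (mpoly_ring Quot I) (quot_scalars I) (quot_piece I i)"

definition maximal_rank ::
    "('r, 'm) ring_scheme \<Rightarrow> 'r set \<Rightarrow> 'r set \<Rightarrow> 'r set \<Rightarrow> ('r \<Rightarrow> 'r) \<Rightarrow> bool" where
  "maximal_rank A K V W f \<longleftrightarrow>
     ring.dim A K (f ` V) = min (ring.dim A K V) (ring.dim A K W)"

definition strong_lefschetz ::
    "('r, 'm) ring_scheme \<Rightarrow> 'r set \<Rightarrow> (nat \<Rightarrow> 'r set) \<Rightarrow> bool" where
  "strong_lefschetz A K G \<longleftrightarrow>
     (\<exists>l\<in>G 1. \<forall>i j. maximal_rank A K (G i) (G (i + j)) (\<lambda>a. l [^]\<^bsub>A\<^esub> j \<otimes>\<^bsub>A\<^esub> a))"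


section \<open>Points in projective space\<close>

text \<open>The point with homogeneous coordinates \<open>p \<noteq> 0\<close> is the set of all its coordinate vectors.\<close>

definition proj_point :: "'k::field ^ 'v \<Rightarrow> ('k ^ 'v) set" where
  "proj_point p = {c *s p | c. c \<noteq> 0}"

definition vanishing_ideal :: "('k::field_char_0 ^ 'v::finite) set set \<Rightarrow> ('k, 'v) mpoly set" where
  "vanishing_ideal Pts = genideal mpoly_ring
     {f. (\<exists>i. f \<in> forms i) \<and> (\<forall>P\<in>Pts. \<forall>p\<in>P. eval_poly f p = 0)}"

definition tau :: "('k::field_char_0 ^ 'v::finite) set set \<Rightarrow> nat" where
  "tau Pts = (LEAST i. hilbert_fun (vanishing_ideal Pts) i = card Pts)"

definition dual_form :: "'k::field_char_0 ^ 'v::finite \<Rightarrow> ('k, 'v) mpoly" where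
  "dual_form p = (\<Sum>v\<in>UNIV. const_poly (p $ v) * var_poly v)"

text \<open>Here \<open>e\<close> numbers the coordinates by \<open>0,\<dots>,n\<close>, where \<open>n = CARD('v) - 1\<close>. Its choice is
  immaterial for \<open>rational_normal_curve\<close>, since the coordinate change \<open>M\<close> absorbs permutations.\<close>

definition veronese :: "('v::finite \<Rightarrow> nat) \<Rightarrow> 'k::field \<Rightarrow> 'k \<Rightarrow> 'k ^ 'v" where
  "veronese e a b = (\<chi> v. a ^ (CARD('v) - 1 - e v) * b ^ e v)"

definition rational_normal_curve :: "('k::field ^ 'v::finite) set set \<Rightarrow> bool" where
  "rational_normal_curve C \<longleftrightarrow>
     (\<exists>(e :: 'v \<Rightarrow> nat) (M :: 'k ^ 'v ^ 'v).
        bij_betw e UNIV {..<CARD('v)} \<and> invertible M \<and>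
        C = {proj_point (M *v veronese e a b) | a b. (a, b) \<noteq> (0, 0)})"

end

theory Submission
  imports Defs
begin

text \<open>The curve is parametrised by binary forms of degree \<open>n\<close>, so the pairing
  \<open>(g, h) \<mapsto> (\<Sum>k. \<alpha>\<^sub>k g(P\<^sub>k) h(P\<^sub>k))\<close> that defines \<open>A\<close> in degree \<open>i\<close> only depends on binary forms of degree
  \<open>n i\<close> and \<open>n (d - i)\<close>: \<open>A\<close> is the \<open>n\<close>-th Veronese subalgebra of a binary Gorenstein algebra. As Lefschetz
  element take a linear form \<open>l\<^sub>c\<close> that restricts to \<open>(a - c b)\<^sup>n\<close> on the curve. For \<open>g\<close> of degree
  \<open>i \<le> d/2\<close>, consider the polynomial \<open>H\<^sub>g = (\<Sum>k. \<alpha>\<^sub>k g(P\<^sub>k) (a\<^sub>k - b\<^sub>k T)^(n (d - i)))\<close>. It vanishes iff \<open>g\<close> is zero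
  in \<open>A\<close>, and \<open>l\<^sub>c^(d - 2i) g = 0\<close> in \<open>A\<close> makes it vanish to order \<open>n i + 1\<close> at \<open>c\<close>. The
  polynomials \<open>H\<^sub>g\<close> form a space spanned by \<open>n i + 1\<close> of them, and in characteristic zero such a space has,
  for all but finitely many \<open>c\<close>, no nonzero member vanishing to that order at \<open>c\<close>. Hence multiplication by
  \<open>l\<^sub>c^(d - 2i)\<close> is injective on \<open>A\<^sub>i\<close> for general \<open>c\<close>, and Gorenstein duality gives the rest.\<close>

section \<open>Forms and apolarity\<close>

lemma forms_zero [simp]: "0 \<in> forms i"
  by (simp add: forms_def)

lemma forms_add: "f \<in> forms i \<Longrightarrow> g \<in> forms i \<Longrightarrow> f + g \<in> forms i"
  using Poly_Mapping.keys_add[of f g] by (auto simp: forms_def)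

lemma forms_sum: "(\<And>x. x \<in> A \<Longrightarrow> f x \<in> forms i) \<Longrightarrow> sum f A \<in> forms i"
  by (induction A rule: infinite_finite_induct) (auto intro: forms_add)

lemma forms_mult:
  fixes f g :: "('k::comm_semiring_1, 'v::finite) mpoly"
  shows "f \<in> forms i \<Longrightarrow> g \<in> forms j \<Longrightarrow> f * g \<in> forms (i + j)"
  using keys_mult[of f g] by (fastforce simp: forms_def lookup_add sum.distrib)

lemma forms_const [simp]: "const_poly c \<in> forms 0"
  by (auto simp: forms_def const_poly_def)

lemma forms_single: "(\<Sum>v\<in>UNIV. lookup m v) = i \<Longrightarrow> Poly_Mapping.single m c \<in> forms i"
  by (auto simp: forms_def)

lemma sum_single [simp]: "(\<Sum>w\<in>UNIV. lookup (Poly_Mapping.single v k) w) = k"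
  for v :: "'v::finite"
  by (simp add: lookup_single when_def)

lemma forms_var [simp]: "var_poly v \<in> forms 1"
  unfolding var_poly_def by (rule forms_single) simp

lemma const_poly_0 [simp]: "const_poly 0 = 0"
  by (simp add: const_poly_def)

lemma const_poly_1: "const_poly 1 = 1"
  by (simp add: const_poly_def)

lemma const_poly_add: "const_poly (a + b) = const_poly a + const_poly b"
  by (simp add: const_poly_def single_add)

lemma const_poly_mult: "const_poly (a * b) = const_poly a * const_poly b"
  for a b :: "'k::comm_semiring_1"
  by (simp add: const_poly_def mult_single)

lemma forms_const_mult: "f \<in> forms i \<Longrightarrow> const_poly c * f \<in> forms i"
  for f :: "('k::comm_semiring_1, 'v::finite) mpoly"
  using forms_mult[OF forms_const[of c], of f i] by simp

lemma forms_one: "(1 :: ('k::comm_semiring_1, 'v::finite) mpoly) \<in> forms 0"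
  by (metis forms_const const_poly_1)

lemma forms_power: "f \<in> forms i \<Longrightarrow> f ^ j \<in> forms (i * j)"
  for f :: "('k::comm_semiring_1, 'v::finite) mpoly"
proof (induction j)
  case 0
  then show ?case using forms_one by simp
next
  case (Suc j)
  then show ?case using forms_mult[of f i "f ^ j" "i * j"] by simp
qed

lemma forms_dual_form: "dual_form p \<in> forms 1"
  unfolding dual_form_def by (intro forms_sum forms_const_mult forms_var)

lemma finite_monomials: "finite {m :: 'v::finite \<Rightarrow>\<^sub>0 nat. (\<Sum>v\<in>UNIV. lookup m v) = i}"
proof (rule finite_imageD)
  show "inj_on lookup {m :: 'v \<Rightarrow>\<^sub>0 nat. (\<Sum>v\<in>UNIV. lookup m v) = i}"
    by (intro inj_onI poly_mapping_eqI) (rule fun_cong)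
  have le: "lookup m v \<le> i" if "(\<Sum>v\<in>UNIV. lookup m v) = i" for m :: "'v \<Rightarrow>\<^sub>0 nat" and v
    using that member_le_sum[of v UNIV "lookup m"] by simp
  show "finite (lookup ` {m :: 'v \<Rightarrow>\<^sub>0 nat. (\<Sum>v\<in>UNIV. lookup m v) = i})"
  proof (rule finite_subset)
    show "lookup ` {m :: 'v \<Rightarrow>\<^sub>0 nat. (\<Sum>v\<in>UNIV. lookup m v) = i} \<subseteq> PiE UNIV (\<lambda>_. {..i})"
      by (intro image_subsetI PiE_I) (simp_all add: le)
  qed (rule finite_PiE, simp_all)
qed

section \<open>Evaluation of polynomials at coordinate vectors\<close>

lemma eval_poly_superset:
  assumes "finite A" "keys f \<subseteq> A"
  shows "eval_poly f p = (\<Sum>m\<in>A. lookup f m * (\<Prod>v\<in>UNIV. p $ v ^ lookup m v))"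
  unfolding eval_poly_def using assms
  by (intro sum.mono_neutral_left) (auto simp: in_keys_iff)

lemma eval_poly_add: "eval_poly (f + g) p = eval_poly f p + eval_poly g p"
proof -
  have "finite (keys f \<union> keys g)" by simp
  then show ?thesis
    using Poly_Mapping.keys_add[of f g]
    by (simp add: eval_poly_superset[of "keys f \<union> keys g"] lookup_add algebra_simps sum.distrib)
qed

lemma eval_poly_0 [simp]: "eval_poly 0 p = 0"
  by (simp add: eval_poly_def)

lemma eval_poly_sum: "eval_poly (sum f A) p = (\<Sum>x\<in>A. eval_poly (f x) p)"
  by (induction A rule: infinite_finite_induct) (auto simp: eval_poly_add)

lemma eval_poly_single: "eval_poly (Poly_Mapping.single m c) p = c * (\<Prod>v\<in>UNIV. p $ v ^ lookup m v)"
  by (simp add: eval_poly_superset[of "{m}"])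

lemma eval_poly_mult: "eval_poly (f * g) p = eval_poly f p * eval_poly g p"
  for f g :: "('k::comm_ring_1, 'v::finite) mpoly"
proof -
  have "f * g = (\<Sum>m\<in>keys f. Poly_Mapping.single m (lookup f m)) *
      (\<Sum>m\<in>keys g. Poly_Mapping.single m (lookup g m))"
    by (simp only: sum_monomials)
  also have "eval_poly \<dots> p = eval_poly f p * eval_poly g p"
    by (simp add: sum_product mult_single eval_poly_sum eval_poly_single)
       (simp add: eval_poly_def sum_product lookup_add power_add prod.distrib mult_ac)
  finally show ?thesis .
qed

lemma eval_poly_const [simp]: "eval_poly (const_poly c) p = c"
  by (simp add: const_poly_def eval_poly_single)

lemma eval_poly_var [simp]: "eval_poly (var_poly v) p = p $ v"
proof -
  have "(\<Prod>w\<in>UNIV. p $ w ^ lookup (Poly_Mapping.single v 1) w) = (\<Prod>w\<in>UNIV. if w = v then p $ v else 1)"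
    by (intro prod.cong) (auto simp: lookup_single when_def)
  then show ?thesis by (simp add: var_poly_def eval_poly_single)
qed

lemma eval_poly_power: "eval_poly (f ^ j) p = eval_poly f p ^ j"
  for f :: "('k::comm_ring_1, 'v::finite) mpoly"
proof (induction j)
  case 0
  show ?case using eval_poly_const[of 1 p] by (simp add: const_poly_1)
qed (simp add: eval_poly_mult)

lemma eval_poly_scale:
  assumes "f \<in> forms i"
  shows "eval_poly f (c *s p) = c ^ i * eval_poly f p"
  unfolding eval_poly_def sum_distrib_left
proof (rule sum.cong)
  fix m assume "m \<in> keys f"
  then have "(\<Sum>v\<in>UNIV. lookup m v) = i" using assms by (auto simp: forms_def)
  then have "(\<Prod>v\<in>UNIV. c ^ lookup m v) = c ^ i" by (simp add: power_sum[symmetric])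
  then show "lookup f m * (\<Prod>v\<in>UNIV. (c *s p) $ v ^ lookup m v) =
      c ^ i * (lookup f m * (\<Prod>v\<in>UNIV. p $ v ^ lookup m v))"
    by (simp add: power_mult_distrib prod.distrib mult.left_commute)
qed simp

section \<open>Linearity of the action and annihilator ideals\<close>

lemma lookup_diff_act_superset:
  fixes g F :: "('k::field_char_0, 'v::finite) mpoly"
  assumes "finite A" "keys g \<subseteq> A"
  shows "lookup (diff_act g F) c = (\<Sum>m\<in>A. lookup g m * lookup F (c + m) *
           (\<Prod>v\<in>UNIV. fact (lookup c v + lookup m v) / fact (lookup c v)))"
  unfolding lookup_diff_act using assms
  by (intro sum.mono_neutral_left) (auto simp: in_keys_iff)

lemma diff_act_add_left: "diff_act (g + h) F = diff_act g F + diff_act h F"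
proof (rule poly_mapping_eqI)
  fix c
  have "finite (keys g \<union> keys h)" by simp
  then show "lookup (diff_act (g + h) F) c = lookup (diff_act g F + diff_act h F) c"
    using Poly_Mapping.keys_add[of g h]
    by (simp add: lookup_diff_act_superset[of "keys g \<union> keys h"] lookup_add algebra_simps sum.distrib)
qed

lemma diff_act_add_right: "diff_act g (F + G) = diff_act g F + diff_act g G"
  by (rule poly_mapping_eqI) (simp add: lookup_diff_act lookup_add algebra_simps sum.distrib)

lemma diff_act_const_right: "diff_act g (const_poly c * F) = const_poly c * diff_act g F"
  by (rule poly_mapping_eqI) (simp add: lookup_diff_act lookup_const_mult sum_distrib_left mult.left_commute mult.assoc)

lemma diff_act_zero_left [simp]: "diff_act 0 F = 0"
  by (simp add: diff_act_def)

lemma diff_act_zero_right [simp]: "diff_act g 0 = 0"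
  by (simp add: diff_act_def)

lemma diff_act_sum_right: "diff_act g (sum F A) = (\<Sum>x\<in>A. diff_act g (F x))"
  by (induction A rule: infinite_finite_induct) (auto simp: diff_act_add_right)

lemma diff_act_const_left: "diff_act (const_poly c) F = const_poly c * F"
proof (rule poly_mapping_eqI)
  fix k
  have "lookup (diff_act (const_poly c) F) k = c * lookup F k"
    by (simp add: lookup_diff_act_superset[of "{0}"] const_poly_def)
  then show "lookup (diff_act (const_poly c) F) k = lookup (const_poly c * F) k"
    by (simp add: lookup_const_mult)
qed

lemma diff_act_1 [simp]: "diff_act 1 F = F"
  using diff_act_const_left[of 1 F] by (simp add: const_poly_1)

text \<open>Only the term of \<open>F\<close> at \<open>m\<close> itself is differentiated to a
  constant. The factorials are nonzero in characteristic zero, so a monomial operator detects a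
  single coefficient.\<close>

lemma lookup_diff_act_single_0:
  "lookup (diff_act (Poly_Mapping.single m 1) F) 0 = lookup F m * (\<Prod>v\<in>UNIV. fact (lookup m v))"
  by (simp add: lookup_diff_act)

lemma ideal_annihilator:
  fixes F :: "('k::field_char_0, 'v::finite) mpoly"
  shows "ideal (annihilator F) mpoly_ring"
proof -
  interpret cring "mpoly_ring :: ('k, 'v) mpoly ring" by (rule cring_from_type_algebra)
  have ring: "ring (mpoly_ring :: ('k, 'v) mpoly ring)" by (rule ring_axioms)
  have neg: "\<ominus>\<^bsub>mpoly_ring\<^esub> g = - g" for g :: "('k, 'v) mpoly"
    by (rule minus_equality) (auto simp: ring_of_type_algebra_def)
  show ?thesis
  proof (rule idealI[OF ring])
    show "subgroup (annihilator F) (add_monoid mpoly_ring)"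
    proof (rule add.subgroupI)
      fix g assume "g \<in> annihilator F"
      moreover have "diff_act (-g) F + diff_act g F = 0"
        by (simp add: diff_act_add_left[symmetric])
      ultimately show "\<ominus>\<^bsub>mpoly_ring\<^esub> g \<in> annihilator F"
        by (simp add: neg annihilator_def)
    qed (auto simp: annihilator_def ring_of_type_algebra_def diff_act_add_left intro: exI[of _ 0])
  next
    fix a x assume a: "a \<in> annihilator F"
    then show "x \<otimes>\<^bsub>mpoly_ring\<^esub> a \<in> annihilator F"
      by (simp add: annihilator_def ring_of_type_algebra_def diff_act_mult)
    with a show "a \<otimes>\<^bsub>mpoly_ring\<^esub> x \<in> annihilator F"
      by (simp add: ring_of_type_algebra_def mult.commute)
  qed
qed

text \<open>The degree count is an equation with a sum instead of membership in
  \<open>forms (d - i)\<close>: truncated subtraction would hide the case \<open>i > d\<close>,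
  where the equation is contradictory and shows that \<open>g\<close> annihilates
  \<open>F\<close>.\<close>

lemma degree_diff_act:
  assumes "F \<in> forms d" "g \<in> forms i" "c \<in> keys (diff_act g F)"
  shows "(\<Sum>v\<in>UNIV. lookup c v) + i = d"
proof -
  have "lookup (diff_act g F) c \<noteq> 0" using assms(3) by (simp add: in_keys_iff)
  then obtain m where m: "m \<in> keys g" "lookup F (c + m) \<noteq> 0"
    unfolding lookup_diff_act by (metis (lifting) mult_eq_0_iff sum.not_neutral_contains_not_neutral)
  then have "c + m \<in> keys F" by (simp add: in_keys_iff)
  with m(1) assms(1,2) show ?thesis
    by (auto simp: forms_def lookup_add sum.distrib)
qed

lemma forms_subset_annihilator:
  assumes "F \<in> forms d" "g \<in> forms i" "i > d"
  shows "g \<in> annihilator F"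
proof -
  have "c \<notin> keys (diff_act g F)" for c
    using degree_diff_act[OF assms(1,2), of c] assms(3) by auto
  then show ?thesis
    unfolding annihilator_def by (auto intro: poly_mapping_eqI simp: in_keys_iff)
qed

lemma diff_act_top:
  assumes "F \<in> forms d" "g \<in> forms d"
  shows "diff_act g F = const_poly (lookup (diff_act g F) 0)"
proof (rule poly_mapping_eqI)
  fix c
  show "lookup (diff_act g F) c = lookup (const_poly (lookup (diff_act g F) 0)) c"
  proof (cases "c \<in> keys (diff_act g F)")
    case True
    then have "c = 0" using degree_diff_act[OF assms True] by (auto intro!: poly_mapping_eqI)
    then show ?thesis by (simp add: const_poly_def)
  next
    case False
    then have "lookup (diff_act g F) c = 0" by (simp add: in_keys_iff)
    then show ?thesis by (cases "c = 0") (simp_all add: const_poly_def lookup_single)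
  qed
qed

text \<open>A form of the same degree as \<open>F\<close> sends \<open>F\<close> to a constant, so
  annihilation in the socle degree is one scalar equation.\<close>

lemma annihilator_top_iff:
  assumes "F \<in> forms d" "g \<in> forms d"
  shows "g \<in> annihilator F \<longleftrightarrow> lookup (diff_act g F) 0 = 0"
proof -
  have "diff_act g F = 0" if "lookup (diff_act g F) 0 = 0"
    by (subst diff_act_top[OF assms]) (simp add: that)
  then show ?thesis by (auto simp: annihilator_def)
qed

text \<open>A nonzero form of degree \<open>i\<close> is detected by pairing it with one of its own monomials.\<close>

lemma annihilator_pairing:
  assumes F: "F \<in> forms (i + j)" and h: "h \<in> forms j"
    and *: "\<And>g. g \<in> forms i \<Longrightarrow> g * h \<in> annihilator F"
  shows "h \<in> annihilator F"
proof (rule ccontr)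
  assume "h \<notin> annihilator F"
  then obtain m where m: "m \<in> keys (diff_act h F)"
    unfolding annihilator_def using poly_mapping_eqI[of "diff_act h F" 0] by (auto simp: in_keys_iff)
  have "(\<Sum>v\<in>UNIV. lookup m v) = i" using degree_diff_act[OF F h m] by simp
  then have "Poly_Mapping.single m 1 * h \<in> annihilator F" by (intro * forms_single)
  then have "lookup (diff_act (Poly_Mapping.single m 1) (diff_act h F)) 0 = 0"
    by (simp add: annihilator_def diff_act_mult)
  with m show False by (simp add: lookup_diff_act_single_0 in_keys_iff)
qed

section \<open>Powers of dual linear forms\<close>

lemma single_mult_eq:
  "Poly_Mapping.single k 1 * G = (\<Sum>m\<in>keys G. Poly_Mapping.single (k + m) (lookup G m))"
  for G :: "('k::comm_ring_1, 'v) mpoly"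
proof -
  have "Poly_Mapping.single k 1 * G = Poly_Mapping.single k 1 * (\<Sum>m\<in>keys G. Poly_Mapping.single m (lookup G m))"
    by (simp only: sum_monomials)
  then show ?thesis by (simp add: sum_distrib_left mult_single)
qed

lemma lookup_single_mult: "lookup (Poly_Mapping.single k 1 * G) (k + m) = lookup G m"
  for G :: "('k::comm_ring_1, 'v) mpoly"
  unfolding single_mult_eq lookup_sum
  by (simp add: lookup_single when_def in_keys_iff)

lemma lookup_var_mult_0:
  fixes G :: "('k::comm_ring_1, 'v) mpoly"
  assumes "lookup m v = 0"
  shows "lookup (var_poly v * G) m = 0"
proof -
  have "Poly_Mapping.single v 1 + b \<noteq> m" for b
    using assms by (metis lookup_add lookup_single_eq add_eq_0_iff_both_eq_0 one_neq_zero)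
  then show ?thesis unfolding var_poly_def single_mult_eq lookup_sum
    by (simp add: lookup_single when_def)
qed

text \<open>The multinomial theorem with its denominators cleared, by induction on \<open>d\<close>,
  splitting one linear factor off the power.\<close>

lemma lookup_dual_form_power:
  assumes "(\<Sum>v\<in>UNIV. lookup m v) = d"
  shows "lookup (dual_form p ^ d) m * (\<Prod>v\<in>UNIV. fact (lookup m v)) = fact d * (\<Prod>v\<in>UNIV. p $ v ^ lookup m v)"
  using assms
proof (induction d arbitrary: m)
  case 0
  then have "m = 0" by (auto intro!: poly_mapping_eqI)
  then show ?case by simp
next
  case (Suc d)
  let ?M = "\<lambda>m. \<Prod>v\<in>UNIV. fact (lookup m v)" and ?P = "\<lambda>m. \<Prod>v\<in>UNIV. p $ v ^ lookup m v"
  \<comment> \<open>This also holds for \<open>lookup m v = 0\<close>, where a multiple of the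
    variable \<open>v\<close> has no term at \<open>m\<close>. Over all \<open>v\<close> the factors
    \<open>lookup m v\<close> add up to \<open>Suc d\<close>, which turns \<open>fact d\<close> into
    \<open>fact (Suc d)\<close>.\<close>
  have summand: "p $ v * lookup (var_poly v * dual_form p ^ d) m * ?M m = of_nat (lookup m v) * (fact d * ?P m)" for v
  proof (cases "lookup m v = 0")
    case True
    then show ?thesis by (simp add: lookup_var_mult_0)
  next
    case False
    define r where "r = m - Poly_Mapping.single v 1"
    have m: "m = Poly_Mapping.single v 1 + r"
      using False by (intro poly_mapping_eqI) (auto simp: r_def lookup_add lookup_minus lookup_single when_def)
    have "(\<Sum>w\<in>UNIV. lookup r w) = d" using Suc.prems by (simp add: m lookup_add sum.distrib)
    note IH = Suc.IH[OF this]
    have lm: "lookup m w = (if w = v then Suc (lookup r w) else lookup r w)" for w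
      by (simp add: m lookup_add lookup_single)
    have M: "?M m = of_nat (lookup m v) * ?M r"
    proof -
      have "?M m = (\<Prod>w\<in>UNIV. (if w = v then of_nat (lookup m v) else 1) * fact (lookup r w))"
        by (intro prod.cong) (auto simp: lm)
      then show ?thesis by (simp add: prod.distrib)
    qed
    have P: "?P m = p $ v * ?P r"
    proof -
      have "?P m = (\<Prod>w\<in>UNIV. (if w = v then p $ v else 1) * p $ w ^ lookup r w)"
        by (intro prod.cong) (auto simp: lm)
      then show ?thesis by (simp add: prod.distrib)
    qed
    have "lookup (var_poly v * dual_form p ^ d) m = lookup (dual_form p ^ d) r"
      unfolding m var_poly_def by (rule lookup_single_mult)
    then have "p $ v * lookup (var_poly v * dual_form p ^ d) m * ?M m =
        p $ v * of_nat (lookup m v) * (lookup (dual_form p ^ d) r * ?M r)"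
      unfolding M by (simp add: mult_ac)
    also have "\<dots> = of_nat (lookup m v) * (fact d * ?P m)"
      unfolding IH P by (simp add: mult_ac)
    finally show ?thesis .
  qed
  have "lookup (dual_form p ^ Suc d) m * ?M m = (\<Sum>v\<in>UNIV. p $ v * lookup (var_poly v * dual_form p ^ d) m * ?M m)"
    unfolding power_Suc dual_form_def[of p] sum_distrib_right
    by (simp add: lookup_sum mult.assoc lookup_const_mult sum_distrib_right flip: dual_form_def)
  also have "\<dots> = of_nat (\<Sum>v\<in>UNIV. lookup m v) * (fact d * ?P m)"
    unfolding summand by (simp add: sum_distrib_right)
  also have "\<dots> = fact (Suc d) * ?P m" by (simp add: Suc.prems mult_ac)
  finally show ?case .
qed

text \<open>The factorials produced by differentiation cancel the denominators of the multinomial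
  coefficients, which leaves the monomials evaluated at \<open>p\<close>.\<close>

lemma diff_act_dual_form_power:
  assumes "g \<in> forms d"
  shows "lookup (diff_act g (dual_form p ^ d)) 0 = fact d * eval_poly g p"
proof -
  have "lookup (diff_act g (dual_form p ^ d)) 0 =
      (\<Sum>m\<in>keys g. lookup g m * (lookup (dual_form p ^ d) m * (\<Prod>v\<in>UNIV. fact (lookup m v))))"
    by (simp add: lookup_diff_act mult.assoc)
  also have "\<dots> = (\<Sum>m\<in>keys g. lookup g m * (fact d * (\<Prod>v\<in>UNIV. p $ v ^ lookup m v)))"
    using assms by (intro sum.cong refl) (auto simp: forms_def lookup_dual_form_power)
  also have "\<dots> = fact d * eval_poly g p"
    by (simp add: eval_poly_def sum_distrib_left mult_ac)
  finally show ?thesis .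
qed

section \<open>Polynomials vanishing to high order\<close>

text \<open>A Wronskian argument without determinants: with \<open>g\<close> the last of the spanning polynomials, passing
  from \<open>h\<close> to \<open>h' g - h g'\<close> lowers both the number of generators and the order of vanishing by one.\<close>

lemma finite_high_order_zeros:
  fixes H :: "nat \<Rightarrow> 'k::field_char_0 Polynomial.poly"
  shows "finite {c. \<exists>a. (\<Sum>i<n. [:a i:] * H i) \<noteq> 0 \<and> [:-c, 1:] ^ n dvd (\<Sum>i<n. [:a i:] * H i)}"
proof (induction n arbitrary: H)
  case 0
  then show ?case by simp
next
  case (Suc n)
  define g where "g = H n"
  define H' where "H' i = pderiv (H i) * g - H i * pderiv g" for i
  let ?B = "{c. \<exists>a. (\<Sum>i<n. [:a i:] * H' i) \<noteq> 0 \<and> [:-c, 1:] ^ n dvd (\<Sum>i<n. [:a i:] * H' i)}"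
  show ?case
  proof (cases "g = 0")
    \<comment> \<open>The last generator is zero, so only \<open>n\<close> of them remain, and order
      \<open>Suc n\<close> at \<open>c\<close> implies order \<open>n\<close>.\<close>
    case True
    show ?thesis
    proof (rule finite_subset[OF _ Suc.IH[of H]], clarify)
      fix c a
      assume "(\<Sum>i<Suc n. [:a i:] * H i) \<noteq> 0" "[:-c, 1:] ^ Suc n dvd (\<Sum>i<Suc n. [:a i:] * H i)"
      with True show "\<exists>a. (\<Sum>i<n. [:a i:] * H i) \<noteq> 0 \<and> [:-c, 1:] ^ n dvd (\<Sum>i<n. [:a i:] * H i)"
        by (intro exI[of _ a]) (auto simp: g_def simp del: power_Suc intro: power_le_dvd[of _ "Suc n"])
    qed
  next
    case False
    show ?thesis
    proof (rule finite_subset)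
      \<comment> \<open>Roots of \<open>g\<close> are set aside because the comparison of orders
        below needs \<open>g\<close> to be nonzero at \<open>c\<close>.\<close>
      show "finite (?B \<union> {c. poly g c = 0})"
        using Suc.IH[of H'] poly_roots_finite[OF False] by simp
      show "{c. \<exists>a. (\<Sum>i<Suc n. [:a i:] * H i) \<noteq> 0 \<and> [:-c, 1:] ^ Suc n dvd (\<Sum>i<Suc n. [:a i:] * H i)}
          \<subseteq> ?B \<union> {c. poly g c = 0}"
      proof clarify
        fix c a
        define h where "h = (\<Sum>i<Suc n. [:a i:] * H i)"
        assume "(\<Sum>i<Suc n. [:a i:] * H i) \<noteq> 0" "[:-c, 1:] ^ Suc n dvd (\<Sum>i<Suc n. [:a i:] * H i)"
          and gc: "poly g c \<noteq> 0"
        then have h: "h \<noteq> 0" "[:-c, 1:] ^ Suc n dvd h" by (simp_all add: h_def)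
        \<comment> \<open>The expression is linear in \<open>h\<close> and vanishes for
          \<open>h = g\<close>, so the coefficient \<open>a n\<close> drops out and \<open>D\<close>
          is a combination of only \<open>n\<close> polynomials.\<close>
        define D where "D = pderiv h * g - h * pderiv g"
        have D_eq: "D = (\<Sum>i<n. [:a i:] * H' i)"
        proof -
          have "pderiv (\<Sum>i<m. [:a i:] * H i) * g - (\<Sum>i<m. [:a i:] * H i) * pderiv g
              = (\<Sum>i<m. [:a i:] * H' i)" for m
            by (induction m) (simp_all add: H'_def pderiv_add pderiv_mult pderiv_smult algebra_simps smult_diff_right)
          from this[of "Suc n"] show ?thesis by (simp add: D_def h_def H'_def g_def)
        qed
        obtain q where q: "h = [:-c, 1:] ^ Suc n * q" using h(2) by (elim dvdE)
        have dvd': "[:-c, 1:] ^ n dvd pderiv h"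
          unfolding q pderiv_mult pderiv_power_Suc 
          by (intro dvd_add dvd_mult2[OF le_imp_power_dvd] dvd_mult[OF dvd_smult] dvd_mult2[OF dvd_smult] dvd_refl)
            (auto simp del: power_Suc intro: dvd_mult dvd_mult2 dvd_smult)
        then have "[:-c, 1:] ^ n dvd D"
          unfolding D_def using power_le_dvd[OF h(2), of n] by (intro dvd_diff dvd_mult2) auto
        \<comment> \<open>Otherwise h' g = h g'. In characteristic zero, h' has order one less than
          \<open>h\<close> at its root \<open>c\<close>, and \<open>g\<close> has order 0 there, so
          the left side would have smaller order than the right side.\<close>
        moreover have "D \<noteq> 0"
        proof
          assume "D = 0"
          then have eq: "pderiv h * g = h * pderiv g" by (simp add: D_def)
          have root: "poly h c = 0" unfolding q by simp
          then have "pderiv h \<noteq> 0"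
            using h(1) by (metis pderiv_iszero pCons_0_0 poly_const_conv)
          have "Polynomial.order c h = Suc (Polynomial.order c (pderiv h))"
            by (rule order_pderiv[OF h(1) root])
          moreover have nz: "pderiv h * g \<noteq> 0" using \<open>pderiv h \<noteq> 0\<close> False by simp
          moreover have "Polynomial.order c g = 0" using gc by (simp add: order_root)
          ultimately show False
            using order_mult[OF nz, of c] order_mult[of h "pderiv g" c] eq by simp
        qed
        ultimately show "\<exists>a. (\<Sum>i<n. [:a i:] * H' i) \<noteq> 0 \<and> [:-c, 1:] ^ n dvd (\<Sum>i<n. [:a i:] * H' i)"
          unfolding D_eq by blast
      qed
    qed
  qed
qed

section \<open>Binary forms and the rational normal curve\<close>

text \<open>A form is kept as a function of its two arguments, with coefficients merely asserted to
  exist: restriction to the curve is then composition with the parametrisation.\<close>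

definition binary_form :: "nat \<Rightarrow> ('k::comm_ring_1 \<Rightarrow> 'k \<Rightarrow> 'k) \<Rightarrow> bool" where
  "binary_form D \<phi> \<longleftrightarrow> (\<exists>q. \<forall>a b. \<phi> a b = (\<Sum>j\<le>D. q j * a ^ (D - j) * b ^ j))"

lemma binary_form_zero: "binary_form D (\<lambda>a b. 0)"
  unfolding binary_form_def by (rule exI[of _ "\<lambda>_. 0"]) simp

lemma binary_form_add:
  assumes "binary_form D \<phi>" "binary_form D \<psi>"
  shows "binary_form D (\<lambda>a b. \<phi> a b + \<psi> a b)"
proof -
  obtain q r where "\<And>a b. \<phi> a b = (\<Sum>j\<le>D. q j * a ^ (D - j) * b ^ j)"
      "\<And>a b. \<psi> a b = (\<Sum>j\<le>D. r j * a ^ (D - j) * b ^ j)"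
    using assms unfolding binary_form_def by blast
  then show ?thesis
    unfolding binary_form_def
    by (intro exI[of _ "\<lambda>j. q j + r j"]) (simp add: distrib_right sum.distrib)
qed

lemma binary_form_cmult:
  assumes "binary_form D \<phi>"
  shows "binary_form D (\<lambda>a b. c * \<phi> a b)"
proof -
  obtain q where "\<And>a b. \<phi> a b = (\<Sum>j\<le>D. q j * a ^ (D - j) * b ^ j)"
    using assms unfolding binary_form_def by blast
  then show ?thesis
    unfolding binary_form_def
    by (intro exI[of _ "\<lambda>j. c * q j"]) (simp add: sum_distrib_left mult.assoc)
qed

lemma binary_form_sum:
  "(\<And>x. x \<in> A \<Longrightarrow> binary_form D (\<phi> x)) \<Longrightarrow> binary_form D (\<lambda>a b. \<Sum>x\<in>A. \<phi> x a b)"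
  by (induction A rule: infinite_finite_induct) (auto intro: binary_form_zero binary_form_add)

lemma binary_form_monomial:
  assumes "j \<le> D"
  shows "binary_form D (\<lambda>a b. a ^ (D - j) * b ^ j)"
  unfolding binary_form_def using assms
  by (intro exI[of _ "\<lambda>l. if l = j then 1 else 0"]) (simp add: if_distrib[of "\<lambda>x. x * _"] cong: if_cong)

lemma binary_form_mult:
  assumes "binary_form D \<phi>" "binary_form E \<psi>"
  shows "binary_form (D + E) (\<lambda>a b. \<phi> a b * \<psi> a b)"
proof -
  obtain q r where q: "\<And>a b. \<phi> a b = (\<Sum>j\<le>D. q j * a ^ (D - j) * b ^ j)"
     and r: "\<And>a b. \<psi> a b = (\<Sum>j\<le>E. r j * a ^ (E - j) * b ^ j)"
    using assms unfolding binary_form_def by blast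
  have "\<phi> a b * \<psi> a b = (\<Sum>i\<le>D. \<Sum>j\<le>E. q i * r j * (a ^ (D + E - (i + j)) * b ^ (i + j)))" for a b
    unfolding q r sum_product
  proof (intro sum.cong refl)
    fix i j assume "i \<in> {..D}" "j \<in> {..E}"
    then have "D + E - (i + j) = (D - i) + (E - j)" by simp
    then show "q i * a ^ (D - i) * b ^ i * (r j * a ^ (E - j) * b ^ j) =
        q i * r j * (a ^ (D + E - (i + j)) * b ^ (i + j))"
      by (simp only: power_add mult_ac)
  qed
  then show ?thesis
    by (simp only:) (intro binary_form_sum binary_form_cmult binary_form_monomial, simp)
qed

lemma binary_form_one: "binary_form 0 (\<lambda>a b. 1)"
  using binary_form_monomial[of 0 0] by simp

lemma binary_form_power:
  assumes "binary_form D \<phi>"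
  shows "binary_form (D * j) (\<lambda>a b. \<phi> a b ^ j)"
proof (induction j)
  case 0
  show ?case using binary_form_one by simp
next
  case (Suc j)
  then show ?case using binary_form_mult[OF assms Suc] by simp
qed

lemma binary_form_prod:
  "(\<And>x. x \<in> A \<Longrightarrow> binary_form (D x) (\<phi> x)) \<Longrightarrow> binary_form (sum D A) (\<lambda>a b. \<Prod>x\<in>A. \<phi> x a b)"
proof (induction A rule: infinite_finite_induct)
  case (insert x A)
  then show ?case using binary_form_mult[of "D x" "\<phi> x" "sum D A" "\<lambda>a b. \<Prod>x\<in>A. \<phi> x a b"] by simp
qed (use binary_form_one in simp_all)

text \<open>These serve as test forms that isolate the coefficients of an expansion around
  \<open>c\<close>; the case \<open>j = 0\<close> yields the Lefschetz element.\<close>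

lemma binary_form_linear_product:
  assumes "j \<le> D"
  shows "binary_form D (\<lambda>a b. b ^ j * (a - c * b) ^ (D - j))"
proof -
  have b: "binary_form 1 (\<lambda>a b. b)" using binary_form_monomial[of 1 1] by simp
  have a: "binary_form 1 (\<lambda>a b. a)" using binary_form_monomial[of 0 1] by simp
  have "binary_form 1 (\<lambda>a b. a - c * b)"
    using binary_form_add[OF a binary_form_cmult[OF b, of "-c"]] by simp
  from binary_form_mult[OF binary_form_power[OF b, of j] binary_form_power[OF this, of "D - j"]]
  show ?thesis using assms by simp
qed

lemma binary_form_eval_poly:
  fixes g :: "('k::field_char_0, 'v::finite) mpoly" and y :: "'k \<Rightarrow> 'k \<Rightarrow> 'k ^ 'v"
  assumes y: "\<And>v. binary_form n (\<lambda>a b. y a b $ v)" and g: "g \<in> forms i"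
  shows "binary_form (n * i) (\<lambda>a b. eval_poly g (y a b))"
  unfolding eval_poly_def
proof (intro binary_form_sum binary_form_cmult)
  fix m assume "m \<in> keys g"
  then have "n * i = (\<Sum>v\<in>UNIV. n * lookup m v)"
    using g by (auto simp: forms_def sum_distrib_left[symmetric])
  then show "binary_form (n * i) (\<lambda>a b. \<Prod>v\<in>UNIV. y a b $ v ^ lookup m v)"
    by (simp only:) (intro binary_form_prod binary_form_power y)
qed

lemma binary_form_curve:
  fixes M :: "'k::field_char_0 ^ 'v::finite ^ 'v"
  assumes "bij_betw e (UNIV :: 'v set) {..<CARD('v)}" and n: "CARD('v) = n + 1"
  shows "binary_form n (\<lambda>a b. (M *v veronese e a b) $ v)"
proof -
  have "e w \<le> n" for w using bij_betw_apply[OF assms(1), of w] n by auto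
  then show ?thesis
    unfolding matrix_vector_mult_def veronese_def
    by (simp add: n) (intro binary_form_sum binary_form_cmult binary_form_monomial)
qed

text \<open>Row \<open>w\<close> of the inverse matrix, read as a linear form, undoes the coordinate
  change and returns coordinate \<open>w\<close> of \<open>veronese\<close>, where \<open>e\<close>
  gives \<open>w\<close> the number \<open>j\<close>.\<close>

lemma ex_linear_form_curve:
  fixes M :: "'k::field_char_0 ^ 'v::finite ^ 'v"
  assumes e: "bij_betw e (UNIV :: 'v set) {..<CARD('v)}" and n: "CARD('v) = n + 1"
    and M: "invertible M" and j: "j \<le> n"
  shows "\<exists>h\<in>forms 1. \<forall>a b. eval_poly h (M *v veronese e a b) = a ^ (n - j) * b ^ j"
proof -
  obtain M' where M': "M' ** M = mat 1" using M unfolding invertible_def by blast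
  obtain w where w: "e w = j" using e j n by (metis bij_betw_iff_bijections lessThan_iff less_Suc_eq_le Suc_eq_plus1)
  define h where "h = dual_form (M' $ w)"
  have "eval_poly h (M *v veronese e a b) = a ^ (n - j) * b ^ j" for a b
  proof -
    have "eval_poly h x = (M' *v x) $ w" for x
      by (simp add: h_def dual_form_def eval_poly_sum eval_poly_mult matrix_vector_mult_def)
    then have "eval_poly h (M *v veronese e a b) = veronese e a b $ w"
      by (simp add: matrix_vector_mul_assoc M')
    then show ?thesis by (simp add: veronese_def w n)
  qed
  then show ?thesis using forms_dual_form h_def by blast
qed

text \<open>Each exponent up to n (i + 1) splits into one at most n and one at most n i, so products
  of linear forms reach all monomials. With \<open>ex_form_curve\<close> this is the projective
  normality of the curve.\<close>

lemma ex_monomial_form_curve: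
  fixes y :: "'k::field_char_0 \<Rightarrow> 'k \<Rightarrow> 'k ^ 'v::finite"
  assumes lin: "\<And>j. j \<le> n \<Longrightarrow> \<exists>h\<in>forms 1. \<forall>a b. eval_poly h (y a b) = a ^ (n - j) * b ^ j"
    and "j \<le> n * i"
  shows "\<exists>h\<in>forms i. \<forall>a b. eval_poly h (y a b) = a ^ (n * i - j) * b ^ j"
  using assms(2)
proof (induction i arbitrary: j)
  case 0
  have "eval_poly 1 x = 1" for x :: "'k ^ 'v" by (metis const_poly_1 eval_poly_const)
  with 0 show ?case using forms_one by auto
next
  case (Suc i)
  obtain j1 j2 where j: "j = j1 + j2" "j1 \<le> n" "j2 \<le> n * i"
  proof
    show "j = min j n + (j - min j n)" "min j n \<le> n" "j - min j n \<le> n * i"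
      using Suc.prems by auto
  qed
  obtain h1 where h1: "h1 \<in> forms 1" "\<And>a b. eval_poly h1 (y a b) = a ^ (n - j1) * b ^ j1"
    using lin[OF j(2)] by blast
  obtain h2 where h2: "h2 \<in> forms i" "\<And>a b. eval_poly h2 (y a b) = a ^ (n * i - j2) * b ^ j2"
    using Suc.IH[OF j(3)] by blast
  have "n * Suc i - j = (n - j1) + (n * i - j2)" using j by simp
  then have "eval_poly (h1 * h2) (y a b) = a ^ (n * Suc i - j) * b ^ j" for a b
    by (simp only: eval_poly_mult h1(2) h2(2) j(1) power_add mult_ac)
  then show ?case using forms_mult[OF h1(1) h2(1)] by auto
qed

lemma ex_form_curve:
  fixes y :: "'k::field_char_0 \<Rightarrow> 'k \<Rightarrow> 'k ^ 'v::finite"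
  assumes lin: "\<And>j. j \<le> n \<Longrightarrow> \<exists>h\<in>forms 1. \<forall>a b. eval_poly h (y a b) = a ^ (n - j) * b ^ j"
    and "binary_form (n * i) \<phi>"
  shows "\<exists>h\<in>forms i. \<forall>a b. eval_poly h (y a b) = \<phi> a b"
proof -
  obtain q where q: "\<And>a b. \<phi> a b = (\<Sum>j\<le>n * i. q j * a ^ (n * i - j) * b ^ j)"
    using assms(2) unfolding binary_form_def by blast
  obtain h where h: "\<And>j. j \<le> n * i \<Longrightarrow> h j \<in> forms i"
      "\<And>j a b. j \<le> n * i \<Longrightarrow> eval_poly (h j) (y a b) = a ^ (n * i - j) * b ^ j"
  proof -
    have "\<forall>j\<in>{..n * i}. \<exists>h. h \<in> forms i \<and> (\<forall>a b. eval_poly h (y a b) = a ^ (n * i - j) * b ^ j)"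
      using ex_monomial_form_curve[of n y, OF lin] by (simp add: Bex_def)
    from bchoice[OF this] show thesis using that by auto
  qed
  show ?thesis
  proof (intro bexI allI)
    show "eval_poly (\<Sum>j\<le>n * i. const_poly (q j) * h j) (y a b) = \<phi> a b" for a b
      unfolding q by (simp add: eval_poly_sum eval_poly_mult h(2) mult.assoc)
    show "(\<Sum>j\<le>n * i. const_poly (q j) * h j) \<in> forms i"
      by (intro forms_sum forms_const_mult h(1)) simp
  qed
qed

text \<open>Taylor expansion at \<open>c\<close>: write a - b T as (a - c b) - b (T - c) and apply
  the binomial theorem.\<close>

lemma linear_power_expansion:
  "[:a, -b:] ^ E = (\<Sum>j\<le>E. [:of_nat (E choose j) * (-1) ^ j * (b ^ j * (a - c * b) ^ (E - j)):] * [:-c, 1:] ^ j)"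
  for a b c :: "'k::comm_ring_1"
proof -
  have "[:a, -b:] = [:-b:] * [:-c, 1:] + [:a - c * b:]" by (simp add: algebra_simps)
  then have "[:a, -b:] ^ E = (\<Sum>j\<le>E. of_nat (E choose j) * ([:-b:] * [:-c, 1:]) ^ j * [:a - c * b:] ^ (E - j))"
    by (simp only: binomial_ring)
  also have "\<dots> = (\<Sum>j\<le>E. [:of_nat (E choose j) * (-1) ^ j * (b ^ j * (a - c * b) ^ (E - j)):] * [:-c, 1:] ^ j)"
  proof (intro sum.cong refl)
    fix j
    have "of_nat (E choose j) * ([:-b:] * [:-c, 1:]) ^ j * [:a - c * b:] ^ (E - j)
        = (of_nat (E choose j) * [:-b:] ^ j * [:a - c * b:] ^ (E - j)) * [:-c, 1:] ^ j"
      by (simp only: power_mult_distrib mult_ac)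
    also have "of_nat (E choose j) * [:-b:] ^ j * [:a - c * b:] ^ (E - j) =
        [:of_nat (E choose j) * (-1) ^ j * (b ^ j * (a - c * b) ^ (E - j)):]"
      by (simp add: of_nat_poly poly_const_pow power_minus[of b] mult_ac)
    finally show "of_nat (E choose j) * ([:-b:] * [:-c, 1:]) ^ j * [:a - c * b:] ^ (E - j)
        = [:of_nat (E choose j) * (-1) ^ j * (b ^ j * (a - c * b) ^ (E - j)):] * [:-c, 1:] ^ j" .
  qed
  finally show ?thesis .
qed

text \<open>By apolarity the two conditions on \<open>g\<close> say that l_c^(d - 2i) g is zero in A
  and that \<open>g\<close> is not. Such a \<open>g\<close> gives a nonzero combination of the
  \<open>Suc N\<close> polynomials \<open>H j\<close> that is divisible by (T - c)^(N + 1), so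
  \<open>finite_high_order_zeros\<close> applies.\<close>

lemma finite_degenerate_directions:
  fixes y :: "'k::field_char_0 \<Rightarrow> 'k \<Rightarrow> 'k ^ 'v::finite" and P :: "'i \<Rightarrow> 'k ^ 'v"
    and l :: "'k \<Rightarrow> ('k, 'v) mpoly"
  assumes restr: "\<And>i g. g \<in> forms i \<Longrightarrow> binary_form (n * i) (\<lambda>a b. eval_poly g (y a b))"
    and onto: "\<And>i \<phi>. binary_form (n * i) \<phi> \<Longrightarrow> \<exists>h\<in>forms i. \<forall>a b. eval_poly h (y a b) = \<phi> a b"
    and P: "\<And>k. k \<in> T \<Longrightarrow> P k = \<gamma> k *s y (a k) (b k)"
    and l: "\<And>c. l c \<in> forms 1" "\<And>c a b. eval_poly (l c) (y a b) = (a - c * b) ^ n"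
    and i: "2 * i \<le> d"
  shows "finite {c. \<exists>g\<in>forms i.
      (\<forall>h\<in>forms i. (\<Sum>k\<in>T. \<alpha> k * eval_poly (l c ^ (d - 2 * i) * g * h) (P k)) = 0) \<and>
      (\<exists>h\<in>forms (d - i). (\<Sum>k\<in>T. \<alpha> k * eval_poly (g * h) (P k)) \<noteq> 0)}"
proof -
  define N E where "N = n * i" and "E = n * (d - i)"
  \<comment> \<open>The contribution of the binary monomial a^(N - j) b^j to the polynomial of a
    form. The factor \<open>\<gamma> k ^ d\<close> comes from moving \<open>P k\<close> to its
    proportional vector on the curve.\<close>
  define H where "H j = (\<Sum>k\<in>T. [:\<alpha> k * \<gamma> k ^ d * a k ^ (N - j) * b k ^ j:] * [:a k, - b k:] ^ E)" for j
  have evalP: "eval_poly f (P k) = \<gamma> k ^ d * eval_poly f (y (a k) (b k))" if "f \<in> forms d" "k \<in> T" for f k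
    using P[OF that(2)] eval_poly_scale[OF that(1)] by simp
  have dE: "d = i + (d - i)" and dl: "d = (d - 2 * i) + i + i" using i by auto
  show ?thesis
  proof (rule finite_subset[OF _ finite_high_order_zeros[where n = "Suc N" and H = H]], clarify)
    fix c g h0
    assume g: "g \<in> forms i"
      and deg: "\<forall>h\<in>forms i. (\<Sum>k\<in>T. \<alpha> k * eval_poly (l c ^ (d - 2 * i) * g * h) (P k)) = 0"
      and h0: "h0 \<in> forms (d - i)" "(\<Sum>k\<in>T. \<alpha> k * eval_poly (g * h0) (P k)) \<noteq> 0"
    \<comment> \<open>The coefficients of \<open>g\<close> on the curve are at the same time those
      of \<open>Hg\<close> in terms of the \<open>H j\<close>.\<close>
    obtain q where q: "\<And>a b. eval_poly g (y a b) = (\<Sum>j\<le>N. q j * a ^ (N - j) * b ^ j)"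
      using restr[OF g] unfolding binary_form_def N_def by blast
    define \<beta> where "\<beta> k = \<alpha> k * \<gamma> k ^ d * eval_poly g (y (a k) (b k))" for k
    define Hg where "Hg = (\<Sum>k\<in>T. [:\<beta> k:] * [:a k, - b k:] ^ E)"
    have const_sum: "(\<Sum>j\<in>J. [:f j:]) = [:\<Sum>j\<in>J. f j:]" for f :: "nat \<Rightarrow> 'k" and J
      by (induction J rule: infinite_finite_induct) auto
    have const_mult: "[:u:] * ([:v:] * p) = [:u * v:] * p" for u v :: 'k and p by (simp add: mult.commute)
    have Hg: "(\<Sum>j<Suc N. [:q j:] * H j) = Hg"
    proof -
      have "(\<Sum>j<Suc N. [:q j:] * H j) =
          (\<Sum>k\<in>T. \<Sum>j\<le>N. [:q j * (\<alpha> k * \<gamma> k ^ d * a k ^ (N - j) * b k ^ j):] * [:a k, - b k:] ^ E)"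
        unfolding H_def lessThan_Suc_atMost sum_distrib_left
        by (subst sum.swap) (simp only: const_mult)
      also have "\<dots> = Hg"
        unfolding Hg_def \<beta>_def q sum_distrib_right[symmetric] const_sum
        by (intro sum.cong refl arg_cong2[of _ _ _ _ "(*)"] arg_cong[of _ _ "\<lambda>x. [:x:]"])
          (simp add: sum_distrib_left mult_ac)
      finally show ?thesis .
    qed
    have "[:-c, 1:] ^ Suc N dvd Hg"
    proof -
      \<comment> \<open>Up to sign and a binomial coefficient, \<open>S j\<close> is the coefficient
        of (T - c)^j in \<open>Hg\<close>.\<close>
      define S where "S j = (\<Sum>k\<in>T. \<beta> k * (b k ^ j * (a k - c * b k) ^ (E - j)))" for j
      have S0: "S j = 0" if jN: "j \<le> N" for j
      proof -
        \<comment> \<open>On the curve l_c^(d - 2i) h becomes b^j (a - c b)^(E - j), because E = n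
          (d - 2i) + N. The assumption \<open>deg\<close> for this \<open>h\<close> is therefore the
          vanishing of \<open>S j\<close>.\<close>
        obtain h where h: "h \<in> forms i" "\<And>a b. eval_poly h (y a b) = b ^ j * (a - c * b) ^ (N - j)"
          using onto[OF binary_form_linear_product[OF jN[unfolded N_def], of c]] unfolding N_def by blast
        have F: "l c ^ (d - 2 * i) * g * h \<in> forms d"
          using forms_mult[OF forms_mult[OF forms_power[OF l(1)] g] h(1), of c "d - 2 * i"] dl by simp
        have "n * d = n * (d - 2 * i) + N + N" unfolding N_def using dl by (metis distrib_left)
        then have e: "E - j = n * (d - 2 * i) + (N - j)"
          using jN by (simp add: E_def N_def diff_mult_distrib2)
        have "0 = (\<Sum>k\<in>T. \<alpha> k * eval_poly (l c ^ (d - 2 * i) * g * h) (P k))"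
          using deg h(1) by simp
        also have "\<dots> = S j"
          unfolding S_def
        proof (intro sum.cong refl)
          fix k assume "k \<in> T"
          show "\<alpha> k * eval_poly (l c ^ (d - 2 * i) * g * h) (P k) =
              \<beta> k * (b k ^ j * (a k - c * b k) ^ (E - j))"
            unfolding evalP[OF F \<open>k \<in> T\<close>] unfolding eval_poly_mult eval_poly_power l(2) h(2) \<beta>_def e power_add power_mult
            by (simp only: mult_ac)
        qed
        finally show ?thesis by simp
      qed
      have "Hg = (\<Sum>j\<le>E. [:of_nat (E choose j) * (-1) ^ j * S j:] * [:-c, 1:] ^ j)"
      proof -
        have "Hg = (\<Sum>k\<in>T. \<Sum>j\<le>E. [:of_nat (E choose j) * (-1) ^ j *
            (\<beta> k * (b k ^ j * (a k - c * b k) ^ (E - j))):] * [:-c, 1:] ^ j)"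
          unfolding Hg_def linear_power_expansion[of _ _ E c] sum_distrib_left
          by (intro sum.cong refl) (simp add: mult_ac)
        also have "\<dots> = (\<Sum>j\<le>E. \<Sum>k\<in>T. [:of_nat (E choose j) * (-1) ^ j *
            (\<beta> k * (b k ^ j * (a k - c * b k) ^ (E - j))):] * [:-c, 1:] ^ j)"
          by (rule sum.swap)
        also have "\<dots> = (\<Sum>j\<le>E. [:of_nat (E choose j) * (-1) ^ j * S j:] * [:-c, 1:] ^ j)"
        proof (intro sum.cong refl)
          fix j
          have "(\<Sum>k\<in>T. [:f k:]) = [:\<Sum>k\<in>T. f k:]" for f :: "'i \<Rightarrow> 'k"
            by (induction T rule: infinite_finite_induct) auto
          then show "(\<Sum>k\<in>T. [:of_nat (E choose j) * (-1) ^ j *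
              (\<beta> k * (b k ^ j * (a k - c * b k) ^ (E - j))):] * [:-c, 1:] ^ j) =
              [:of_nat (E choose j) * (-1) ^ j * S j:] * [:-c, 1:] ^ j"
            unfolding sum_distrib_right[symmetric] S_def by (simp only: sum_distrib_left)
        qed
        finally show ?thesis .
      qed
      also have "[:-c, 1:] ^ Suc N dvd \<dots>"
      proof (rule dvd_sum)
        \<comment> \<open>Terms up to \<open>N\<close> vanish by \<open>S0\<close>; each later term
          contains the required power as a factor.\<close>
        fix j assume "j \<in> {..E}"
        show "[:-c, 1:] ^ Suc N dvd [:of_nat (E choose j) * (-1) ^ j * S j:] * [:-c, 1:] ^ j"
        proof (cases "j \<le> N")
          case True
          then show ?thesis by (simp only: S0 mult_zero_right) simp
        next
          case False
          then show ?thesis by (intro dvd_mult le_imp_power_dvd) simp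
        qed
      qed
      finally show ?thesis .
    qed
    moreover have "Hg \<noteq> 0"
    proof
      assume "Hg = 0"
      \<comment> \<open>Now the expansion is at 0: the coefficients of \<open>Hg\<close> are these
        sums times a sign and a binomial coefficient, which is nonzero in characteristic zero. They
        determine the pairing of \<open>g\<close> with any form of degree d - i, so
        \<open>h0\<close> is contradicted.\<close>
      have S0: "(\<Sum>k\<in>T. \<beta> k * (a k ^ (E - j) * b k ^ j)) = 0" if "j \<le> E" for j
      proof -
        have "0 = Polynomial.coeff Hg j" using \<open>Hg = 0\<close> by simp
        also have "\<dots> = (\<Sum>k\<in>T. \<beta> k * (of_nat (E choose j) * (- b k) ^ j * a k ^ (E - j)))"
          using that unfolding Hg_def by (simp add: Polynomial.coeff_sum coeff_linear_poly_power)
        also have "\<dots> = of_nat (E choose j) * (-1) ^ j * (\<Sum>k\<in>T. \<beta> k * (a k ^ (E - j) * b k ^ j))"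
          unfolding sum_distrib_left
          by (intro sum.cong refl) (subst power_minus, simp only: mult_ac)
        finally show ?thesis using that by simp
      qed
      obtain r where r: "\<And>a b. eval_poly h0 (y a b) = (\<Sum>j\<le>E. r j * a ^ (E - j) * b ^ j)"
        using restr[OF h0(1)] unfolding binary_form_def E_def by blast
      have F: "g * h0 \<in> forms d" using forms_mult[OF g h0(1)] dE by simp
      have "(\<Sum>k\<in>T. \<alpha> k * eval_poly (g * h0) (P k)) =
          (\<Sum>k\<in>T. \<Sum>j\<le>E. r j * (\<beta> k * (a k ^ (E - j) * b k ^ j)))"
      proof (intro sum.cong refl)
        fix k assume "k \<in> T"
        have "\<alpha> k * eval_poly (g * h0) (P k) = \<beta> k * eval_poly h0 (y (a k) (b k))"
          unfolding evalP[OF F \<open>k \<in> T\<close>] unfolding eval_poly_mult \<beta>_def by (simp only: mult_ac)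
        then show "\<alpha> k * eval_poly (g * h0) (P k) = (\<Sum>j\<le>E. r j * (\<beta> k * (a k ^ (E - j) * b k ^ j)))"
          unfolding r sum_distrib_left by (simp only: mult_ac)
      qed
      also have "\<dots> = (\<Sum>j\<le>E. r j * (\<Sum>k\<in>T. \<beta> k * (a k ^ (E - j) * b k ^ j)))"
        by (subst sum.swap) (simp only: sum_distrib_left)
      also have "\<dots> = 0" by (simp add: S0)
      finally show False using h0(2) by simp
    qed
    ultimately show "\<exists>q. (\<Sum>j<Suc N. [:q j:] * H j) \<noteq> 0 \<and> [:-c, 1:] ^ Suc N dvd (\<Sum>j<Suc N. [:q j:] * H j)"
      unfolding Hg[symmetric] by blast
  qed
qed

section \<open>Lefschetz property of Gorenstein algebras\<close>

context ring
begin

lemma dimension_le: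
  assumes K: "subfield K R" and "dimension n K U" "dimension m K V" "U \<subseteq> V"
  shows "n \<le> m"
proof -
  obtain Us where Us: "set Us \<subseteq> carrier R" "independent K Us" "length Us = n" "Span K Us = U"
    using exists_base[OF K assms(2)] by blast
  have "set Us \<subseteq> V" using Span_base_incl[OF K Us(1)] Us(4) assms(4) by blast
  from independent_length_le_dimension[OF K assms(3) Us(2) this] show ?thesis by (simp only: Us(3))
qed

lemma dimension_eq:
  assumes K: "subfield K R" and "dimension n K U" "dimension n K V" "U \<subseteq> V"
  shows "U = V"
proof -
  obtain Us where Us: "set Us \<subseteq> carrier R" "independent K Us" "length Us = n" "Span K Us = U"
    using exists_base[OF K assms(2)] by blast
  have "set Us \<subseteq> V" using Span_base_incl[OF K Us(1)] Us(4) assms(4) by blast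
  from independent_length_eq_dimension[OF K assms(3) Us(2) this] show ?thesis using Us(3,4) by blast
qed

text \<open>The induction carries each \<open>line_extension\<close> that builds \<open>V\<close>
  over to the image. Commuting with \<open>K\<close> is what makes multiplication by
  \<open>a\<close> linear in a general ring.\<close>

lemma dimension_image_mult:
  assumes K: "subfield K R" and c: "\<And>k. k \<in> K \<Longrightarrow> k \<otimes> a = a \<otimes> k" and a: "a \<in> carrier R"
    and "dimension n K V" and inj: "\<And>v. v \<in> V \<Longrightarrow> a \<otimes> v = \<zero> \<Longrightarrow> v = \<zero>"
  shows "dimension n K ((\<lambda>v. a \<otimes> v) ` V)"
  using assms(4,5)
proof (induction n arbitrary: V)
  case 0
  then have "V = {\<zero>}" by (intro dimension_zero[OF K])
  then show ?case using a by simp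
next
  case (Suc n)
  from Suc.prems(1) obtain v E where v: "v \<in> carrier R" "v \<notin> E" "dimension n K E" and V: "V = line_extension K v E"
    by (cases rule: dimension.cases) auto
  have E: "E \<subseteq> carrier R" and Kc: "K \<subseteq> carrier R"
    using space_subgroup_props(1)[OF K v(3)] subring_props(1)[OF K] by auto
  have mem: "k \<otimes> v \<oplus> e \<in> V" if "k \<in> K" "e \<in> E" for k e
    unfolding V line_extension_mem_iff using that by blast
  have EV: "e \<in> V" if "e \<in> E" for e
  proof -
    have "\<zero> \<otimes> v \<oplus> e = e" using that E v(1) by auto
    then show ?thesis using mem[OF subring_props(2)[OF K] that] by simp
  qed
  have "dimension n K ((\<lambda>v. a \<otimes> v) ` E)"
    by (rule Suc.IH[OF v(3)]) (rule Suc.prems(2)[OF EV])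
  moreover have "a \<otimes> v \<notin> (\<lambda>v. a \<otimes> v) ` E"
  proof
    assume "a \<otimes> v \<in> (\<lambda>v. a \<otimes> v) ` E"
    then obtain e where e: "e \<in> E" "a \<otimes> v = a \<otimes> e" by auto
    have ec: "e \<in> carrier R" using e(1) E by auto
    have "\<one> \<otimes> v \<oplus> (\<ominus> e) \<in> V"
      using mem[OF subring_props(3)[OF K]] space_subgroup_props(4)[OF K v(3) e(1)] by blast
    moreover have "a \<otimes> (\<one> \<otimes> v \<oplus> (\<ominus> e)) = \<zero>"
      using a v(1) ec e(2) by (simp add: r_distr r_minus r_neg)
    ultimately have "\<one> \<otimes> v \<oplus> (\<ominus> e) = \<zero>" by (rule Suc.prems(2))
    then have "v \<ominus> e = \<zero>" using v(1) by (simp add: minus_eq)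
    then have "v = e" using v(1) ec by simp
    with e(1) v(2) show False by simp
  qed
  moreover have "(\<lambda>v. a \<otimes> v) ` V = line_extension K (a \<otimes> v) ((\<lambda>v. a \<otimes> v) ` E)"
  proof -
    have eq: "a \<otimes> (k \<otimes> v \<oplus> e) = k \<otimes> (a \<otimes> v) \<oplus> a \<otimes> e" if "k \<in> K" "e \<in> E" for k e
    proof -
      have "k \<in> carrier R" "e \<in> carrier R" using that Kc E by auto
      then show ?thesis using a v(1) c[OF that(1)] by (simp add: r_distr m_assoc[symmetric])
    qed
    show ?thesis
    proof (intro subset_antisym subsetI)
      fix x assume "x \<in> (\<lambda>v. a \<otimes> v) ` V"
      then obtain z where "z \<in> line_extension K v E" "x = a \<otimes> z" unfolding V by blast
      then obtain k e where "k \<in> K" "e \<in> E" "x = a \<otimes> (k \<otimes> v \<oplus> e)"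
        unfolding line_extension_mem_iff by blast
      then show "x \<in> line_extension K (a \<otimes> v) ((\<lambda>v. a \<otimes> v) ` E)"
        unfolding line_extension_mem_iff using eq by blast
    next
      fix x assume "x \<in> line_extension K (a \<otimes> v) ((\<lambda>v. a \<otimes> v) ` E)"
      then obtain k e where ke: "k \<in> K" "e \<in> E" and "x = k \<otimes> (a \<otimes> v) \<oplus> a \<otimes> e"
        unfolding line_extension_mem_iff by blast
      then have "x = a \<otimes> (k \<otimes> v \<oplus> e)" by (simp only: eq)
      then show "x \<in> (\<lambda>v. a \<otimes> v) ` V" using mem[OF ke] by blast
    qed
  qed
  ultimately show ?case using a v(1) by (simp add: Suc_dim)
qed

end

text \<open>Induction on the dimension of \<open>U\<close>: after splitting off a vector
  \<open>u\<close>, the part of \<open>V\<close> killed by \<open>u\<close> has codimension at most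
  one, and the remaining space \<open>E\<close> alone still separates it.\<close>

lemma (in cring) dimension_pairing_le:
  assumes K: "subfield K R" and w: "w \<in> carrier R"
    and "dimension n K U" "dimension m K V"
    and top: "\<And>u v. u \<in> U \<Longrightarrow> v \<in> V \<Longrightarrow> \<exists>k\<in>K. u \<otimes> v = k \<otimes> w"
    and nondeg: "\<And>v. v \<in> V \<Longrightarrow> (\<And>u. u \<in> U \<Longrightarrow> u \<otimes> v = \<zero>) \<Longrightarrow> v = \<zero>"
  shows "m \<le> n"
  using assms(3-6)
proof (induction n arbitrary: U V m)
  case 0
  have "V \<subseteq> carrier R" by (rule space_subgroup_props(1)[OF K 0(2)])
  then have "v = \<zero>" if "v \<in> V" for v
    using that 0(4)[OF that] dimension_zero[OF K 0(1)] by auto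
  then have "V = {\<zero>}" using space_subgroup_props(2)[OF K 0(2)] by blast
  then have "dimension 0 K V" by simp
  with 0(2) have "m = 0" using dimension_is_inj[OF K] by blast
  then show ?case by simp
next
  case (Suc n)
  note top = Suc.prems(3) and nondeg = Suc.prems(4)
  from Suc.prems(1) obtain u E where u: "u \<in> carrier R" "u \<notin> E" "dimension n K E" and U: "U = line_extension K u E"
    by (cases rule: dimension.cases) auto
  have Kc: "K \<subseteq> carrier R" by (rule subring_props(1)[OF K])
  have Ec: "E \<subseteq> carrier R" by (rule space_subgroup_props(1)[OF K u(3)])
  note Vp = space_subgroup_props[OF K Suc.prems(2)]
  have mem: "k \<otimes> u \<oplus> e \<in> U" if "k \<in> K" "e \<in> E" for k e
    unfolding U line_extension_mem_iff using that by blast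
  have EU: "e \<in> U" if "e \<in> E" for e
  proof -
    have "\<zero> \<otimes> u \<oplus> e = e" using that Ec u(1) by auto
    then show ?thesis using mem[OF subring_props(2)[OF K] that] by simp
  qed
  have uU: "u \<in> U"
    using mem[OF subring_props(3)[OF K] space_subgroup_props(2)[OF K u(3)]] u(1) by simp
  define V' where "V' = {v \<in> V. u \<otimes> v = \<zero>}"
  have "subalgebra K V' R"
  proof (intro subalgebra.intro add.subgroupI subalgebra_axioms.intro)
    show "V' \<subseteq> carrier R" using Vp(1) by (auto simp: V'_def)
    show "V' \<noteq> {}" using Vp(2) u(1) by (auto simp: V'_def intro!: exI[of _ \<zero>])
    show "\<ominus> v \<in> V'" if "v \<in> V'" for v
      using that Vp(1,4) u(1) by (auto simp: V'_def r_minus subset_iff)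
    show "v \<oplus> v' \<in> V'" if "v \<in> V'" "v' \<in> V'" for v v'
      using that Vp(1,3) u(1) by (auto simp: V'_def r_distr subset_iff)
    show "k \<otimes> v \<in> V'" if "k \<in> K" "v \<in> V'" for k v
    proof -
      have "k \<in> carrier R" "v \<in> carrier R" "v \<in> V" "u \<otimes> v = \<zero>" using that Kc Vp(1) by (auto simp: V'_def)
      then show ?thesis using Vp(5)[OF that(1)] u(1) by (simp add: V'_def m_lcomm)
    qed
  qed
  moreover have "V' \<subseteq> V" by (auto simp: V'_def)
  ultimately have "finite_dimension K V'"
    by (rule subalbegra_incl_imp_finite_dimension[OF K finite_dimensionI[OF Suc.prems(2)]])
  then obtain m' where m': "dimension m' K V'"
    unfolding finite_dimension_def by blast
  have "m' \<le> n"
  proof (rule Suc.IH[OF u(3) m'])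
    show "\<exists>k\<in>K. e \<otimes> v = k \<otimes> w" if "e \<in> E" "v \<in> V'" for e v
      using top[OF EU[OF that(1)]] that(2) by (auto simp: V'_def)
    show "v = \<zero>" if v: "v \<in> V'" and 0: "\<And>e. e \<in> E \<Longrightarrow> e \<otimes> v = \<zero>" for v
    proof (rule nondeg)
      show "v \<in> V" using v by (auto simp: V'_def)
      then have vc: "v \<in> carrier R" using Vp(1) by auto
      fix x assume "x \<in> U"
      then obtain k e where x: "k \<in> K" "e \<in> E" "x = k \<otimes> u \<oplus> e"
        unfolding U line_extension_mem_iff by auto
      have "k \<in> carrier R" "e \<in> carrier R" using x Kc Ec by auto
      then show "x \<otimes> v = \<zero>"
        using vc u(1) 0[OF x(2)] v unfolding x(3) by (simp add: V'_def l_distr m_assoc)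
    qed
  qed
  moreover have "m \<le> Suc m'"
  proof (cases "V' = V")
    case True
    then show ?thesis using m' Suc.prems(2) dimension_is_inj[OF K] by fastforce
  next
    case False
    \<comment> \<open>All products with \<open>u\<close> lie on the line through \<open>w\<close>,
      so a single \<open>v0\<close> not killed by \<open>u\<close> spans \<open>V\<close> modulo
      \<open>V'\<close>: subtracting the multiple of \<open>v0\<close> by the quotient of the two
      coefficients lands in \<open>V'\<close>.\<close>
    then obtain v0 where v0: "v0 \<in> V" "u \<otimes> v0 \<noteq> \<zero>" by (auto simp: V'_def)
    have v0c: "v0 \<in> carrier R" using v0 Vp(1) by auto
    obtain k0 where k0: "k0 \<in> K" "u \<otimes> v0 = k0 \<otimes> w" using top[OF uU v0(1)] by blast
    have k0': "k0 \<in> K - {\<zero>}" using k0 v0(2) w by auto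
    note inv = subfield_m_inv[OF K k0']
    have "V = line_extension K v0 V'"
    proof (intro subset_antisym subsetI)
      fix v assume v: "v \<in> V"
      have vc: "v \<in> carrier R" using v Vp(1) by auto
      obtain k where k: "k \<in> K" "u \<otimes> v = k \<otimes> w" using top[OF uU v] by blast
      define t where "t = k \<otimes> inv k0"
      have tK: "t \<in> K" unfolding t_def using k(1) inv(1) subring_props(6)[OF K] by auto
      then have tc: "t \<in> carrier R" using Kc by auto
      have kc: "k \<in> carrier R" "k0 \<in> carrier R" "inv k0 \<in> carrier R" using k(1) k0(1) inv(1) Kc by auto
      have tv: "t \<otimes> v0 \<in> V" by (rule Vp(5)[OF tK v0(1)])
      have "u \<otimes> (t \<otimes> v0) = t \<otimes> (u \<otimes> v0)" using u(1) tc v0c by (simp add: m_lcomm)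
      also have "\<dots> = k \<otimes> (inv k0 \<otimes> k0) \<otimes> w" unfolding t_def k0(2) using kc w by (simp add: m_assoc)
      also have "\<dots> = u \<otimes> v" using inv(3) kc k(2) by simp
      finally have "u \<otimes> (v \<oplus> \<ominus> (t \<otimes> v0)) = \<zero>"
        using u(1) vc tc v0c by (simp add: r_distr r_minus r_neg)
      then have "v \<oplus> \<ominus> (t \<otimes> v0) \<in> V'" using Vp(3)[OF v Vp(4)[OF tv]] by (simp add: V'_def)
      moreover have "v = t \<otimes> v0 \<oplus> (v \<oplus> \<ominus> (t \<otimes> v0))"
        using vc tc v0c by (simp add: a_lcomm r_neg)
      ultimately show "v \<in> line_extension K v0 V'"
        unfolding line_extension_mem_iff using tK by blast
    next
      fix v assume "v \<in> line_extension K v0 V'"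
      then show "v \<in> V" unfolding line_extension_mem_iff using Vp(3,5) v0(1) by (auto simp: V'_def)
    qed
    moreover have "v0 \<notin> V'" using v0 by (auto simp: V'_def)
    ultimately have "dimension (Suc m') K V" using Suc_dim[OF v0c _ m'] by simp
    then show ?thesis using Suc.prems(2) dimension_is_inj[OF K] by fastforce
  qed
  ultimately show ?case by simp
qed

text \<open>The pairing into \<open>G d\<close> forces \<open>dim (G (d - i)) \<le> dim (G i)\<close>, so that injectivity of
  \<open>l\<^sup>d\<^sup>-\<^sup>2\<^sup>i\<close> on \<open>G i\<close> already gives bijectivity onto \<open>G (d - i)\<close>; every other multiplication by a
  power of \<open>l\<close> is a right or a left factor of one of these bijections.\<close>

lemma (in cring) strong_lefschetzI:
  assumes K: "subfield K R" and w: "w \<in> carrier R"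
    and fin: "\<And>i. finite_dimension K (G i)"
    and mult: "\<And>i j u v. u \<in> G i \<Longrightarrow> v \<in> G j \<Longrightarrow> u \<otimes> v \<in> G (i + j)"
    and one: "\<one> \<in> G 0"
    and zero: "\<And>i. i > d \<Longrightarrow> G i = {\<zero>}"
    and top: "\<And>u. u \<in> G d \<Longrightarrow> \<exists>k\<in>K. u = k \<otimes> w"
    and nondeg: "\<And>i j v. i + j = d \<Longrightarrow> v \<in> G j \<Longrightarrow> (\<And>u. u \<in> G i \<Longrightarrow> u \<otimes> v = \<zero>) \<Longrightarrow> v = \<zero>"
    and l: "l \<in> G 1"
    and inj: "\<And>i v. 2 * i \<le> d \<Longrightarrow> v \<in> G i \<Longrightarrow> l [^] (d - 2 * i) \<otimes> v = \<zero> \<Longrightarrow> v = \<zero>"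
  shows "strong_lefschetz R K G"
proof -
  define h where "h i = (dim over K) (G i)" for i
  have h: "dimension (h i) K (G i)" for i
    unfolding h_def by (rule finite_dimensionE[OF K fin])
  have dim: "dim K V = n" if "dimension n K V" for n V
    using dimI[OF K that] by (simp add: over_def)
  have Gc: "G i \<subseteq> carrier R" for i by (rule space_subgroup_props(1)[OF K h])
  have G0: "\<zero> \<in> G i" for i by (rule space_subgroup_props(2)[OF K h])
  have lc: "l \<in> carrier R" using l Gc by auto
  have pow: "l [^] j \<in> G j" for j :: nat
  proof (induction j)
    case (Suc j)
    then show ?case using mult[OF Suc l] by simp
  qed (use one in simp)
  have img: "(\<lambda>a. l [^] j \<otimes> a) ` G i \<subseteq> G (i + j)" for i j :: nat
    using mult[OF pow, of _ i j] by (auto simp: add.commute)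
  have Kl: "k \<otimes> l [^] j = l [^] j \<otimes> k" if "k \<in> K" for k and j :: nat
    using that subring_props(1)[OF K] lc by (auto intro: m_comm)
  have dual: "h j \<le> h i" if "i + j = d" for i j
    using that by (intro dimension_pairing_le[OF K w h h]) (auto intro: top nondeg mult)
  have split: "l [^] (i + j) \<otimes> v = l [^] i \<otimes> (l [^] j \<otimes> v)" if "v \<in> G m" for i j m :: nat and v
  proof -
    have "v \<in> carrier R" using that Gc by blast
    then show ?thesis using lc by (simp add: nat_pow_mult[symmetric] m_assoc)
  qed
  have factor: "v = \<zero>" if "2 * i + j \<le> d" "v \<in> G i" "l [^] j \<otimes> v = \<zero>" for i j :: nat and v
  proof (rule inj)
    show "2 * i \<le> d" "v \<in> G i" using that by auto
    have "d - 2 * i = (d - 2 * i - j) + j" using that(1) by simp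
    then have "l [^] (d - 2 * i) \<otimes> v = l [^] (d - 2 * i - j) \<otimes> (l [^] j \<otimes> v)"
      using split[OF that(2), of "d - 2 * i - j" j] by (simp only:)
    then show "l [^] (d - 2 * i) \<otimes> v = \<zero>" using that(3) lc by simp
  qed
  have dim_img: "dimension (h i) K ((\<lambda>a. l [^] j \<otimes> a) ` G i)" if "2 * i + j \<le> d" for i j :: nat
    by (rule dimension_image_mult[OF K Kl nat_pow_closed[OF lc] h factor[OF that]])
  have rank: "maximal_rank R K (G i) (G (i + j)) (\<lambda>a. l [^] j \<otimes> a)" for i j :: nat
  proof -
    \<comment> \<open>In turn: multiplication is injective, the target lies beyond the socle degree,
      or multiplication is surjective.\<close>
    consider "2 * i + j \<le> d" | "d < i + j" | "d < 2 * i + j" "i + j \<le> d" by linarith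
    then show ?thesis
    proof cases
      case 1
      note D = dim_img[OF 1]
      have "h i \<le> h (i + j)" by (rule dimension_le[OF K D h img])
      then show ?thesis using dim[OF D] dim[OF h] by (simp add: maximal_rank_def)
    next
      case 2
      have "(\<lambda>a. l [^] j \<otimes> a) ` G i \<subseteq> {\<zero>}" using img[of j i] unfolding zero[OF 2] .
      moreover have "(\<lambda>a. l [^] j \<otimes> a) ` G i \<noteq> {}" using G0[of i] by blast
      ultimately have im: "(\<lambda>a. l [^] j \<otimes> a) ` G i = {\<zero>}" by (metis subset_singletonD)
      show ?thesis unfolding maximal_rank_def im zero[OF 2] dim[OF zero_dim] by simp
    next
      case 3
      \<comment> \<open>The degree dual to \<open>i + j\<close>; here it is below \<open>i\<close>.
        The bijection from degree \<open>i'\<close> onto degree \<open>i + j\<close> factors through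
        degree \<open>i\<close>, so its last factor, multiplication by the \<open>j\<close>-th
        power, is surjective.\<close>
      define i' where "i' = d - i - j"
      have i': "i' + (i + j) = d" "2 * i' + (d - 2 * i') \<le> d" "i' + (d - 2 * i') = i + j" "2 * i' + (i - i') \<le> d"
          "i' + (i - i') = i" "d - 2 * i' = j + (i - i')"
        using 3 unfolding i'_def by auto
      note D = dim_img[OF i'(2)]
      have sub: "(\<lambda>a. l [^] (d - 2 * i') \<otimes> a) ` G i' \<subseteq> G (i + j)"
        using img[of "d - 2 * i'" i'] i'(3) by simp
      have "h i' = h (i + j)" using dual[OF i'(1)] dimension_le[OF K D h sub] by simp
      then have eq: "(\<lambda>a. l [^] (d - 2 * i') \<otimes> a) ` G i' = G (i + j)"
        using dimension_eq[OF K D _ sub] h[of "i + j"] by simp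
      have "h i' \<le> h i"
        using dimension_le[OF K dim_img[OF i'(4)] h] img[of "i - i'" i'] i'(5) by simp
      moreover have "(\<lambda>a. l [^] j \<otimes> a) ` G i = G (i + j)"
      proof (rule subset_antisym[OF img subsetI])
        fix x assume "x \<in> G (i + j)"
        then obtain v where v: "v \<in> G i'" "x = l [^] (d - 2 * i') \<otimes> v" using eq by blast
        have "x = l [^] j \<otimes> (l [^] (i - i') \<otimes> v)"
          unfolding v(2) i'(6) by (rule split[OF v(1)])
        moreover have "l [^] (i - i') \<otimes> v \<in> G i" using img[of "i - i'" i'] v(1) i'(5) by auto
        ultimately show "x \<in> (\<lambda>a. l [^] j \<otimes> a) ` G i" by blast
      qed
      ultimately show ?thesis
        using dim[OF h] \<open>h i' = h (i + j)\<close> by (simp add: maximal_rank_def)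
    qed
  qed
  show ?thesis
    unfolding strong_lefschetz_def by (intro bexI[OF _ l] allI rank)
qed

text \<open>Covers a zero dual generator, whose quotient is the zero ring and has no subfield of
  scalars. The three dimensions compared in \<open>maximal_rank\<close> are then those of the same
  set.\<close>

lemma strong_lefschetz_trivial:
  assumes "cring A" "\<And>i. G i = {\<zero>\<^bsub>A\<^esub>}"
  shows "strong_lefschetz A K G"
proof -
  interpret cring A by fact
  show ?thesis unfolding strong_lefschetz_def maximal_rank_def assms(2)
    by (intro bexI[of _ "\<zero>\<^bsub>A\<^esub>"] allI) simp_all
qed

section \<open>The quotient by the annihilator of a form\<close>

locale inverse_system =
  fixes F :: "('k::field_char_0, 'v::finite) mpoly" and d :: nat
  assumes F: "F \<in> forms d"
begin

abbreviation I where "I \<equiv> annihilator F"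
abbreviation A where "A \<equiv> mpoly_ring Quot I"
abbreviation proj where "proj f \<equiv> I +>\<^bsub>mpoly_ring\<^esub> f"

sublocale ideal I mpoly_ring by (rule ideal_annihilator)

lemma cring_quotient: "cring A"
  by (intro quotient_is_cring cring_from_type_algebra)

sublocale quotient: cring A by (rule cring_quotient)

lemma carrier_mpoly_ring [simp]: "carrier (mpoly_ring :: ('k, 'v) mpoly ring) = UNIV"
  by (simp add: ring_of_type_algebra_def)

lemma proj_mult: "proj (f * g) = proj f \<otimes>\<^bsub>A\<^esub> proj g"
  using ring_hom_mult[OF rcos_ring_hom, of f g] by (simp add: ring_of_type_algebra_def)

lemma proj_add: "proj (f + g) = proj f \<oplus>\<^bsub>A\<^esub> proj g"
  using ring_hom_add[OF rcos_ring_hom, of f g] by (simp add: ring_of_type_algebra_def)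

lemma proj_one: "proj 1 = \<one>\<^bsub>A\<^esub>"
  using ring_hom_one[OF rcos_ring_hom] by (simp add: ring_of_type_algebra_def)

lemma proj_closed [simp]: "proj f \<in> carrier A"
  using ring_hom_closed[OF rcos_ring_hom, of f] by simp

lemma proj_eq_zero_iff: "proj f = \<zero>\<^bsub>A\<^esub> \<longleftrightarrow> f \<in> I"
  using a_rcos_zero[OF ideal_annihilator, of f] rcos_const_imp_mem[of f] by (auto simp: FactRing_def)

lemma proj_power: "proj (f ^ j) = proj f [^]\<^bsub>A\<^esub> j"
  by (induction j) (simp_all add: proj_one proj_mult power_Suc2 del: power_Suc)

lemma proj_eqI: "f - g \<in> I \<Longrightarrow> proj f = proj g"
  using proj_add[of "f - g" g] proj_eq_zero_iff[of "f - g"] by simp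

lemma I_mult: "f \<in> I \<Longrightarrow> g * f \<in> I"
  by (simp add: annihilator_def diff_act_mult)

text \<open>A homomorphic image of a field is a subfield as soon as one differs from zero in the
  target; since 1 acts as the identity, this is where \<open>F\<close> must be nonzero.\<close>

lemma subfield_quot_scalars:
  assumes "F \<noteq> 0"
  shows "subfield (quot_scalars I) A"
proof -
  interpret k: field "ring_of_type_algebra :: 'k ring" by (rule field_from_type_algebra)
  have "(\<lambda>c. proj (const_poly c)) \<in> ring_hom (ring_of_type_algebra :: 'k ring) A"
    by (rule ring_hom_memI)
      (simp_all add: ring_of_type_algebra_def[where 'a = 'k] const_poly_mult const_poly_add const_poly_1 proj_mult proj_add proj_one)
  then have hom: "ring_hom_ring (ring_of_type_algebra :: 'k ring) A (\<lambda>c. proj (const_poly c))"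
    by (intro ring_hom_ringI2 k.ring_axioms quotient.ring_axioms)
  have "1 \<notin> I" using assms by (simp add: annihilator_def)
  then have "\<one>\<^bsub>A\<^esub> \<noteq> \<zero>\<^bsub>A\<^esub>" using proj_eq_zero_iff[of 1] by (simp add: proj_one)
  from ring_hom_ring.img_is_subfield(2)[OF hom k.carrier_is_subfield this]
  show ?thesis by (simp add: quot_scalars_def ring_of_type_algebra_def[where 'a = 'k])
qed

text \<open>The piece is a subspace of the span of the finitely many monomial classes of degree
  \<open>i\<close>.\<close>

lemma finite_dimension_quot_piece:
  assumes "F \<noteq> 0"
  shows "quotient.finite_dimension (quot_scalars I) (quot_piece I i)"
proof -
  let ?K = "quot_scalars I"
  note K = subfield_quot_scalars[OF assms]
  obtain ms where ms: "set ms = {m :: 'v \<Rightarrow>\<^sub>0 nat. (\<Sum>v\<in>UNIV. lookup m v) = i}"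
    using finite_list[OF finite_monomials] by blast
  define Us where "Us = map (\<lambda>m. proj (Poly_Mapping.single m 1)) ms"
  have Us: "set Us \<subseteq> carrier A" by (auto simp: Us_def)
  note Span = quotient.Span_subgroup_props[OF K Us] quotient.Span_smult_closed[OF K Us]
  have "quot_piece I i \<subseteq> quotient.Span ?K Us"
  proof
    fix x assume "x \<in> quot_piece I i"
    then obtain f where f: "f \<in> forms i" "x = proj f" by (auto simp: quot_piece_def)
    have mono: "proj (Poly_Mapping.single m c) \<in> quotient.Span ?K Us" if "m \<in> set ms" for m c
    proof -
      have "proj (const_poly c) \<otimes>\<^bsub>A\<^esub> proj (Poly_Mapping.single m 1) \<in> quotient.Span ?K Us"
        using that quotient.Span_base_incl[OF K Us]
        by (intro Span(5)) (auto simp: quot_scalars_def Us_def)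
      then show ?thesis by (simp add: proj_mult[symmetric] const_poly_def mult_single)
    qed
    have "proj (\<Sum>m\<in>M. Poly_Mapping.single m (lookup f m)) \<in> quotient.Span ?K Us"
      if "finite M" "M \<subseteq> set ms" for M
      using that
    proof (induction M rule: finite_induct)
      case empty
      have "proj 0 = \<zero>\<^bsub>A\<^esub>" unfolding proj_eq_zero_iff by (simp add: annihilator_def)
      then show ?case using Span(2) by simp
    next
      case (insert m M)
      then have "proj (Poly_Mapping.single m (lookup f m)) \<oplus>\<^bsub>A\<^esub>
          proj (\<Sum>m\<in>M. Poly_Mapping.single m (lookup f m)) \<in> quotient.Span ?K Us"
        by (intro Span(3) mono) blast+
      then show ?case by (simp only: sum.insert[OF insert(1,2)] proj_add)
    qed
    from this[of "keys f"] show "x \<in> quotient.Span ?K Us"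
      using f by (auto simp: sum_monomials ms forms_def)
  qed
  \<comment> \<open>Here \<open>subalgebra\<close> amounts to a linear subspace: closure under sums,
    negatives and scalar multiples.\<close>
  moreover have "subalgebra ?K (quot_piece I i) A"
  proof (intro subalgebra.intro quotient.add.subgroupI subalgebra_axioms.intro)
    show "quot_piece I i \<subseteq> carrier A" by (auto simp: quot_piece_def)
    have "proj 0 \<in> quot_piece I i" unfolding quot_piece_def by (intro imageI forms_zero)
    then show "quot_piece I i \<noteq> {}" by blast
    show "x \<oplus>\<^bsub>A\<^esub> y \<in> quot_piece I i" if "x \<in> quot_piece I i" "y \<in> quot_piece I i" for x y
      using that by (auto simp: quot_piece_def proj_add[symmetric] intro!: imageI forms_add)
    show smult: "k \<otimes>\<^bsub>A\<^esub> x \<in> quot_piece I i" if "k \<in> ?K" "x \<in> quot_piece I i" for k x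
      using that
      by (auto simp: quot_piece_def quot_scalars_def proj_mult[symmetric] intro!: imageI forms_const_mult)
    show "\<ominus>\<^bsub>A\<^esub> x \<in> quot_piece I i" if x: "x \<in> quot_piece I i" for x
    proof -
      have "\<ominus>\<^bsub>A\<^esub> \<one>\<^bsub>A\<^esub> \<in> ?K"
        using quotient.subring_props(3,5)[OF K] by simp
      moreover have "x \<in> carrier A" using x by (auto simp: quot_piece_def)
      then have "\<ominus>\<^bsub>A\<^esub> x = \<ominus>\<^bsub>A\<^esub> \<one>\<^bsub>A\<^esub> \<otimes>\<^bsub>A\<^esub> x" by (simp add: quotient.l_minus)
      ultimately show ?thesis using smult x by simp
    qed
  qed
  ultimately show ?thesis
    using quotient.subalbegra_incl_imp_finite_dimension[OF K quotient.Span_finite_dimension[OF K Us]] by blast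
qed

text \<open>\<open>annihilator_pairing\<close> supplies the nondegenerate pairing and
  \<open>annihilator_top_iff\<close> the one-dimensional socle, so the injectivity condition is all
  that remains, and it is stated for polynomials instead of classes.\<close>

lemma strong_lefschetz_annihilatorI:
  assumes l: "l \<in> forms 1"
    and inj: "\<And>i g. 2 * i \<le> d \<Longrightarrow> g \<in> forms i \<Longrightarrow> l ^ (d - 2 * i) * g \<in> I \<Longrightarrow> g \<in> I"
  shows "strong_lefschetz A (quot_scalars I) (quot_piece I)"
proof (cases "F = 0")
  case True
  then have "I = UNIV" by (simp add: annihilator_def)
  then have "proj f = \<zero>\<^bsub>A\<^esub>" for f using proj_eq_zero_iff by blast
  then have "quot_piece I i = {\<zero>\<^bsub>A\<^esub>}" for i
    unfolding quot_piece_def using forms_zero[of i] by blast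
  then show ?thesis by (rule strong_lefschetz_trivial[OF cring_quotient])
next
  case False
  \<comment> \<open>Since 1 does not annihilate a nonzero \<open>F\<close>, pairing with 1 produces
    such an \<open>f\<close>; its class spans degree \<open>d\<close>.\<close>
  obtain f where f: "f \<in> forms d" "f \<notin> I"
  proof -
    have "\<not> (\<forall>g\<in>forms d. g * 1 \<in> I)"
      using annihilator_pairing[of F d 0 1] F forms_one False by (auto simp: annihilator_def)
    then show thesis using that by auto
  qed
  have f0: "lookup (diff_act f F) 0 \<noteq> 0" using f annihilator_top_iff[OF F f(1)] by blast
  show ?thesis
  proof (rule quotient.strong_lefschetzI[where d = d and w = "proj f" and l = "proj l"])
    show "subfield (quot_scalars I) A" by (rule subfield_quot_scalars[OF False])
    show "quotient.finite_dimension (quot_scalars I) (quot_piece I i)" for i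
      by (rule finite_dimension_quot_piece[OF False])
    show "u \<otimes>\<^bsub>A\<^esub> v \<in> quot_piece I (i + j)" if "u \<in> quot_piece I i" "v \<in> quot_piece I j" for i j u v
      using that by (auto simp: quot_piece_def proj_mult[symmetric] intro!: imageI forms_mult)
    show "\<one>\<^bsub>A\<^esub> \<in> quot_piece I 0" using forms_one by (auto simp: quot_piece_def proj_one[symmetric])
    show "quot_piece I i = {\<zero>\<^bsub>A\<^esub>}" if "i > d" for i
    proof -
      have g: "proj g = \<zero>\<^bsub>A\<^esub>" if "g \<in> forms i" for g
        using forms_subset_annihilator[OF F that \<open>i > d\<close>] by (simp add: proj_eq_zero_iff)
      have "quot_piece I i = (\<lambda>_ :: ('k, 'v) mpoly. \<zero>\<^bsub>A\<^esub>) ` forms i"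
        unfolding quot_piece_def by (rule image_cong[OF refl]) (rule g)
      then show ?thesis by (simp only: image_constant[OF forms_zero])
    qed
    show "\<exists>k\<in>quot_scalars I. u = k \<otimes>\<^bsub>A\<^esub> proj f" if u: "u \<in> quot_piece I d" for u
    proof -
      obtain g where g: "g \<in> forms d" "u = proj g" using u by (auto simp: quot_piece_def)
      \<comment> \<open>Chosen to cancel the constant terms, so that
        \<open>g - const_poly c * f\<close> annihilates \<open>F\<close>.\<close>
      define c where "c = lookup (diff_act g F) 0 / lookup (diff_act f F) 0"
      have eq: "g - const_poly c * f = g + const_poly (-c) * f"
      proof -
        have "const_poly c * f + const_poly (-c) * f = 0"
          by (simp add: const_poly_add[symmetric] flip: distrib_right)
        then show ?thesis by (simp add: diff_eq_eq add.assoc add.commute)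
      qed
      have "g - const_poly c * f \<in> forms d"
        unfolding eq by (intro forms_add g(1) forms_const_mult f(1))
      moreover have "lookup (diff_act (g - const_poly c * f) F) 0 = 0"
        unfolding eq using f0 by (simp add: diff_act_add_left diff_act_mult diff_act_const_left lookup_add lookup_const_mult c_def)
      ultimately have "proj g = proj (const_poly c * f)"
        by (intro proj_eqI) (simp add: annihilator_top_iff[OF F])
      then show ?thesis unfolding g(2) proj_mult quot_scalars_def by blast
    qed
    show "v = \<zero>\<^bsub>A\<^esub>" if ij: "i + j = d" and v: "v \<in> quot_piece I j"
      and *: "\<And>u. u \<in> quot_piece I i \<Longrightarrow> u \<otimes>\<^bsub>A\<^esub> v = \<zero>\<^bsub>A\<^esub>" for i j v
    proof -
      obtain h where h: "h \<in> forms j" "v = proj h" using v by (auto simp: quot_piece_def)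
      have "h \<in> I"
      proof (rule annihilator_pairing[of F i j])
        fix g :: "('k, 'v) mpoly" assume "g \<in> forms i"
        then have "proj g \<otimes>\<^bsub>A\<^esub> proj h = \<zero>\<^bsub>A\<^esub>" using *[of "proj g"] h(2) by (auto simp: quot_piece_def)
        then show "g * h \<in> I" by (simp add: proj_mult[symmetric] proj_eq_zero_iff)
      qed (use F ij h in simp_all)
      then show ?thesis by (simp add: h(2) proj_eq_zero_iff)
    qed
    show "proj l \<in> quot_piece I 1" using l by (auto simp: quot_piece_def)
    show "v = \<zero>\<^bsub>A\<^esub>" if i: "2 * i \<le> d" and v: "v \<in> quot_piece I i"
      and *: "proj l [^]\<^bsub>A\<^esub> (d - 2 * i) \<otimes>\<^bsub>A\<^esub> v = \<zero>\<^bsub>A\<^esub>" for i v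
    proof -
      obtain g where g: "g \<in> forms i" "v = proj g" using v by (auto simp: quot_piece_def)
      have "l ^ (d - 2 * i) * g \<in> I"
        using * by (simp add: g(2) proj_power[symmetric] proj_mult[symmetric] proj_eq_zero_iff)
      then have "g \<in> I" by (rule inj[OF i g(1)])
      then show ?thesis by (simp add: g(2) proj_eq_zero_iff)
    qed
  qed simp
qed

end

section \<open>Sums of powers of linear forms\<close>

text \<open>Acting on a \<open>d\<close>-th power of a dual form evaluates at its point, up to the
  nonzero factor \<open>fact d\<close>. This passes from the algebra to weighted sums of values at
  the points.\<close>

lemma annihilator_sum_of_powers_iff:
  fixes \<alpha> :: "'i \<Rightarrow> 'k::field_char_0" and P :: "'i \<Rightarrow> 'k ^ 'v::finite"
  assumes F: "F = (\<Sum>k\<in>T. const_poly (\<alpha> k) * dual_form (P k) ^ d)" and f: "f \<in> forms d"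
  shows "f \<in> annihilator F \<longleftrightarrow> (\<Sum>k\<in>T. \<alpha> k * eval_poly f (P k)) = 0"
proof -
  have "F \<in> forms d"
    unfolding F using forms_power[OF forms_dual_form, of _ d] by (intro forms_sum forms_const_mult) simp
  moreover have "lookup (diff_act f F) 0 = fact d * (\<Sum>k\<in>T. \<alpha> k * eval_poly f (P k))"
    unfolding F diff_act_sum_right lookup_sum sum_distrib_left diff_act_const_right lookup_const_mult
      diff_act_dual_form_power[OF f] by (simp only: mult.left_commute)
  ultimately show ?thesis using annihilator_top_iff[OF _ f] by simp
qed

theorem theorem4p3:
  fixes n s d :: nat
    and P :: "nat \<Rightarrow> 'k::field_char_0 ^ 'v::finite"
    and Pts C :: "('k ^ 'v) set set"
    and \<alpha> :: "nat \<Rightarrow> 'k"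
    and F :: "('k, 'v) mpoly"
  assumes "CARD('v) = n + 1"
    and "s \<ge> 1"
    and "\<And>i. i \<in> {1..s} \<Longrightarrow> P i \<noteq> 0"
    and "inj_on (\<lambda>i. proj_point (P i)) {1..s}"
    and "Pts = (\<lambda>i. proj_point (P i)) ` {1..s}"
    and "rational_normal_curve C"
    and "Pts \<subseteq> C"
    and "d \<ge> 2 * tau Pts"
    and "\<And>i. i \<in> {1..s} \<Longrightarrow> \<alpha> i \<noteq> 0"
    and "F = (\<Sum>i=1..s. const_poly (\<alpha> i) * dual_form (P i) ^ d)"
  shows "strong_lefschetz (mpoly_ring Quot annihilator F)
           (quot_scalars (annihilator F)) (quot_piece (annihilator F))"
proof -
  note n = assms(1) and F_eq = assms(10)
  have Fd: "F \<in> forms d"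
    unfolding F_eq using forms_power[OF forms_dual_form, of _ d] by (intro forms_sum forms_const_mult) simp
  obtain e and M :: "'k ^ 'v ^ 'v" where e: "bij_betw e (UNIV :: 'v set) {..<CARD('v)}" and M: "invertible M"
    and C: "C = {proj_point (M *v veronese e a b) | a b. (a, b) \<noteq> (0, 0)}"
    using assms(6) unfolding rational_normal_curve_def by blast
  define y where "y a b = M *v veronese e a b" for a b
  have lin: "\<exists>h\<in>forms 1. \<forall>a b. eval_poly h (y a b) = a ^ (n - j) * b ^ j" if "j \<le> n" for j
    unfolding y_def by (rule ex_linear_form_curve[OF e n M that])
  have restr: "binary_form (n * i) (\<lambda>a b. eval_poly g (y a b))" if "g \<in> forms i" for i g
    by (rule binary_form_eval_poly[OF _ that]) (unfold y_def, rule binary_form_curve[OF e n])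
  have onto: "\<exists>h\<in>forms i. \<forall>a b. eval_poly h (y a b) = \<phi> a b" if "binary_form (n * i) \<phi>" for i \<phi>
    by (rule ex_form_curve[OF lin that])
  \<comment> \<open>The chosen coordinates of a point are only proportional to a parametrised
    vector, so each \<open>k\<close> receives a scalar along with its two parameters.\<close>
  have "\<forall>k\<in>{1..s}. \<exists>t. P k = fst t *s y (fst (snd t)) (snd (snd t))"
  proof
    fix k assume "k \<in> {1..s}"
    then have "proj_point (P k) \<in> C" using assms(5,7) by blast
    then obtain a b where ab: "proj_point (P k) = proj_point (y a b)" unfolding C y_def by blast
    have "P k \<in> proj_point (P k)" unfolding proj_point_def by (auto intro!: exI[of _ 1])
    then obtain c where "P k = c *s y a b" unfolding ab unfolding proj_point_def by blast
    then show "\<exists>t. P k = fst t *s y (fst (snd t)) (snd (snd t))" by (intro exI[of _ "(c, a, b)"]) simp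
  qed
  from bchoice[OF this] obtain t where t: "\<And>k. k \<in> {1..s} \<Longrightarrow> P k = fst (t k) *s y (fst (snd (t k))) (snd (snd (t k)))"
    by blast
  \<comment> \<open>Candidates for the Lefschetz element, one for each \<open>c\<close> in the
    field.\<close>
  have "\<forall>c. \<exists>h. h \<in> forms 1 \<and> (\<forall>a b. eval_poly h (y a b) = (a - c * b) ^ n)"
  proof
    fix c :: 'k
    have "binary_form (n * 1) (\<lambda>a b. (a - c * b) ^ n)" using binary_form_linear_product[of 0 n c] by simp
    from onto[OF this] show "\<exists>h. h \<in> forms 1 \<and> (\<forall>a b. eval_poly h (y a b) = (a - c * b) ^ n)"
      by (simp only: Bex_def)
  qed
  from choice[OF this] obtain l where l: "\<And>c. l c \<in> forms 1" "\<And>c a b. eval_poly (l c) (y a b) = (a - c * b) ^ n"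
    by blast
  \<comment> \<open>The values of \<open>c\<close> for which some nonzero class of degree
    \<open>i\<close> is killed by l_c^(d - 2i).\<close>
  define bad where "bad i = {c. \<exists>g\<in>forms i.
      (\<forall>h\<in>forms i. (\<Sum>k\<in>{1..s}. \<alpha> k * eval_poly (l c ^ (d - 2 * i) * g * h) (P k)) = 0) \<and>
      (\<exists>h\<in>forms (d - i). (\<Sum>k\<in>{1..s}. \<alpha> k * eval_poly (g * h) (P k)) \<noteq> 0)}" for i
  have "finite (bad i)" if "2 * i \<le> d" for i
    unfolding bad_def by (rule finite_degenerate_directions[where y = y, OF restr onto t l that])
  then have "finite (\<Union>i\<in>{i. 2 * i \<le> d}. bad i)"
    by (intro finite_UN_I finite_subset[of "{i. 2 * i \<le> d}" "{..d}"]) auto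
  \<comment> \<open>A field of characteristic zero is infinite, so one \<open>c\<close> works for
    all degrees \<open>i\<close> at once.\<close>
  then obtain c where c: "c \<notin> (\<Union>i\<in>{i. 2 * i \<le> d}. bad i)"
    using ex_new_if_finite[OF infinite_UNIV_char_0] by blast
  interpret inverse_system F d by unfold_locales (rule Fd)
  show ?thesis
  proof (rule strong_lefschetz_annihilatorI[OF l(1)[of c]])
    fix i g assume i: "2 * i \<le> d" and g: "g \<in> forms i" and lg: "l c ^ (d - 2 * i) * g \<in> annihilator F"
    have dd: "d - 2 * i + i + i = d" "i + (d - i) = d" "d - i + i = d" using i by auto
    have "(\<Sum>k\<in>{1..s}. \<alpha> k * eval_poly (l c ^ (d - 2 * i) * g * h) (P k)) = 0" if h: "h \<in> forms i" for h
    proof -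
      have "l c ^ (d - 2 * i) * g * h \<in> forms d"
        using forms_mult[OF forms_mult[OF forms_power[OF l(1)[of c], of "d - 2 * i"] g] h] dd(1) by simp
      moreover have "l c ^ (d - 2 * i) * g * h \<in> annihilator F"
        using I_mult[OF lg, of h] by (simp only: mult.commute)
      ultimately show ?thesis using annihilator_sum_of_powers_iff[OF F_eq] by blast
    qed
    \<comment> \<open>As \<open>c\<close> is not bad, being killed by l_c^(d - 2i) forces
      \<open>g\<close> to pair to zero with every form of degree \<open>d - i\<close>; nondegeneracy
      then makes \<open>g\<close> zero in A.\<close>
    moreover have "c \<notin> bad i" using c i by blast
    ultimately have *: "(\<Sum>k\<in>{1..s}. \<alpha> k * eval_poly (g * h) (P k)) = 0" if "h \<in> forms (d - i)" for h
      using g that unfolding bad_def by blast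
    show "g \<in> annihilator F"
    proof (rule annihilator_pairing[of F "d - i" i])
      show "F \<in> forms (d - i + i)" using Fd dd(3) by simp
      fix h :: "('k, 'v) mpoly" assume h: "h \<in> forms (d - i)"
      have "g * h \<in> forms d" using forms_mult[OF g h] dd(2) by simp
      then have "g * h \<in> annihilator F" using *[OF h] annihilator_sum_of_powers_iff[OF F_eq] by blast
      then show "h * g \<in> annihilator F" by (simp only: mult.commute)
    qed (rule g)
  qed
qed

end
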